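(* Let $D$ be a weighted oriented graph (in which, by convention, every source has weight $1$), let $G$ be its underlying graph, and let $I(D)\subset S=K[t_1,\ldots,t_s]$ be its edge ideal. If $I(D)$ has no embedded primes, then the following conditions are equivalent: (a) $\mathrm{Ass}(I(D)^n)=\mathrm{Ass}(I(D))$ for all $n\geq 1$, i.e., $I(D)$ is normally torsion-free; (b) $I(D)^{n}=I(D)^{(n)}$ for all $n\geq 1$; (c) every vertex in $V^{+}(D)$ is a sink and $G$ is bipartite.
   Context: Let $G$ be a finite simple graph with vertex set $\{t_1,\ldots,t_s\}$ and edge set $E(G)$. A weighted oriented graph $D$ with underlying graph $G$ is a triple $(V(D),E(D),w)$ where $V(D)=V(G)$, $E(D)\subset V(D)\times V(D)$ satisfies $E(G)=\{\{t_i,t_j\}\mid (t_i,t_j)\in E(D)\}$ and $|E(D)|=|E(G)|$ (so each edge of $G$ receives exactly one direction), and $w\colon V(D)\to\{1,2,3,\ldots\}$ is a weight function; write $w_i=w(t_i)$. The edge $(t_i,t_j)$ is directed from $t_i$ to $t_j$. A source is a vertex with only outgoing edges; a sink is a vertex with only incoming edges. Standing convention: every source of $D$ has weight $1$. Set $V^+(D)=\{t_i\in V(D)\mid w_i>1\}$. Let $K$ be a field and $S=K[t_1,\ldots,t_s]$, with the vertices regarded as variables. The edge ideal of $D$ is $I(D)=(\{t_it_j^{w_j}\mid (t_i,t_j)\in E(D)\})\subset S$. For an ideal $I$ of $S$, $\mathrm{Ass}(I)$ denotes the set of associated primes of $I$, i.e. the prime ideals of the form $(I\colon f)=\{g\in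 S\mid gf\in I\}$ with $f\in S$. An embedded prime of $I$ is an associated prime that properly contains another associated prime of $I$. For $n\ge 1$, the $n$-th symbolic power of $I$ is defined using the minimal primes: if $\mathfrak p_1,\ldots,\mathfrak p_r$ are the minimal (non-embedded associated) primes of $I$, then $I^{(n)}=\bigcap_{i=1}^r (I^nS_{\mathfrak p_i}\cap S)$. *)

theory Defs
  imports
    "HOL-Library.Poly_Mapping"
    "HOL-Computational_Algebra.Polynomial_Factorial"
    "HOL-Algebra.Ideal_Product"
    "HOL-Algebra.Algebraic_Closure_Type"
begin

section \<open>Weighted oriented graphs\<close>

text \<open>The vertex set is the universe of a finite type. Following the usual numbering
  $t_1, \dots, t_s$ of the vertices, this type is linearly ordered; the order is used only for the
  library's proof that the polynomial ring on the vertices is an integral domain.\<close>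

definition simple_graph :: "'v set set \<Rightarrow> bool" where
  "simple_graph G \<longleftrightarrow> (\<forall>e\<in>G. card e = 2)"

definition weighted_oriented_graph :: "'v::finite set set \<Rightarrow> ('v \<times> 'v) set \<Rightarrow> ('v \<Rightarrow> nat) \<Rightarrow> bool" where
  "weighted_oriented_graph G E w \<longleftrightarrow>
     simple_graph G \<and> G = {{a, b} |a b. (a, b) \<in> E} \<and> card E = card G \<and> (\<forall>v. 1 \<le> w v)"

text \<open>An isolated vertex has no edges at all, so it is both a source and a sink.\<close>

definition source :: "('v \<times> 'v) set \<Rightarrow> 'v \<Rightarrow> bool" where
  "source E v \<longleftrightarrow> (\<forall>u. (u, v) \<notin> E)"

definition sink :: "('v \<times> 'v) set \<Rightarrow> 'v \<Rightarrow> bool" where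
  "sink E v \<longleftrightarrow> (\<forall>u. (v, u) \<notin> E)"

definition V_plus :: "('v \<Rightarrow> nat) \<Rightarrow> 'v set" where
  "V_plus w = {v. w v > 1}"

definition bipartite :: "'v set set \<Rightarrow> bool" where
  "bipartite G \<longleftrightarrow> (\<exists>A. \<forall>e\<in>G. \<exists>a\<in>A. \<exists>b\<in>-A. e = {a, b})"

section \<open>Associated primes and symbolic powers\<close>

definition colon :: "('a, 'b) ring_scheme \<Rightarrow> 'a set \<Rightarrow> 'a \<Rightarrow> 'a set" where
  "colon R I f = {g \<in> carrier R. g \<otimes>\<^bsub>R\<^esub> f \<in> I}"

definition Ass :: "('a, 'b) ring_scheme \<Rightarrow> 'a set \<Rightarrow> 'a set set" where
  "Ass R I = {P. primeideal P R \<and> (\<exists>f\<in>carrier R. P = colon R I f)}"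

definition embedded_prime :: "('a, 'b) ring_scheme \<Rightarrow> 'a set \<Rightarrow> 'a set \<Rightarrow> bool" where
  "embedded_prime R I P \<longleftrightarrow> P \<in> Ass R I \<and> (\<exists>Q\<in>Ass R I. Q \<subset> P)"

definition minimal_primes :: "('a, 'b) ring_scheme \<Rightarrow> 'a set \<Rightarrow> 'a set set" where
  "minimal_primes R I = {P \<in> Ass R I. \<not> embedded_prime R I P}"

text \<open>Powers are taken in the library's semiring of ideals, so the zeroth power is the whole
  ring and each further step multiplies by \<open>I\<close> with the ideal product.\<close>

abbreviation ideal_power :: "('a, 'b) ring_scheme \<Rightarrow> 'a set \<Rightarrow> nat \<Rightarrow> 'a set" where
  "ideal_power R I n \<equiv> I [^]\<^bsub>ideals_set R\<^esub> n"

text \<open>For an integral domain and a prime ideal \<open>P\<close>, the localization at \<open>P\<close> is the subring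
  of the fraction field formed by the fractions with a denominator outside \<open>P\<close>. Such a
  denominator is nonzero because \<open>0 \<in> P\<close>.\<close>

definition localization :: "'a::idom set \<Rightarrow> 'a fract ring" where
  "localization P = ring_of_type_algebra\<lparr>carrier := {Fract a b |a b. b \<notin> P}\<rparr>"

definition extended_ideal :: "'a::idom set \<Rightarrow> 'a set \<Rightarrow> 'a fract set" where
  "extended_ideal P J = Idl\<^bsub>localization P\<^esub> (to_fract ` J)"

definition symbolic_power :: "'a::idom set \<Rightarrow> nat \<Rightarrow> 'a set" where
  "symbolic_power I n =
     (\<Inter>P\<in>minimal_primes ring_of_type_algebra I.
        to_fract -` extended_ideal P (ideal_power ring_of_type_algebra I n))"

section \<open>Edge ideals\<close>

text \<open>The polynomial ring $K[t_1,\dots,t_s]$ is the type of finitely supported functions from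
  exponent vectors to coefficients, with the convolution product.\<close>

type_synonym ('v, 'k) mpoly = "('v \<Rightarrow>\<^sub>0 nat) \<Rightarrow>\<^sub>0 'k"

definition indet :: "'v \<Rightarrow> ('v, 'k::field) mpoly" where
  "indet v = Poly_Mapping.single (Poly_Mapping.single v 1) 1"

definition edge_ideal :: "('v \<times> 'v) set \<Rightarrow> ('v \<Rightarrow> nat) \<Rightarrow> ('v, 'k::field) mpoly set" where
  "edge_ideal E w = Idl\<^bsub>ring_of_type_algebra\<^esub> {indet i * indet j ^ w j |i j. (i, j) \<in> E}"

end

theory Submission
  imports Defs
begin

text \<open>All ideals that occur are monomial, so everything is read off from up-closed sets of exponent
vectors. For such a set \<open>U\<close>, the associated primes of the monomial ideal of \<open>U\<close> are generated by
variables; they correspond to the vertex sets \<open>C\<close> in \<open>assoc U\<close> (\<open>Ass_mono_ideal\<close>). Contracting the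
extension to the localization at such a prime means allowing multiplication by monomials that avoid
\<open>C\<close>, which gives the set \<open>loc C U\<close> (\<open>contraction_mono_ideal\<close>). The combinatorial primary
decomposition \<open>assoc_separates\<close> says that \<open>U\<close> is the intersection of the \<open>loc C U\<close> over \<open>assoc U\<close>.

If the powers have the associated primes of $I$, and none of these is embedded, the decomposition of
$I^n$ is the intersection that defines $I^{(n)}$. So (a) implies (b).

From (b) to (c): when $I$ has no embedded prime, its associated primes belong to minimal vertex
covers, so a vertex $v$ of such a cover has a neighbour outside it, and $t_v^{w_v}$ lies in the localized
ideal. If $z \to x \to y$ are edges and $w_x > 1$, then $t_z t_x^{w_x} t_y^{w_y}$ lies in $I^{(2)}$ but
not in $I^2$ (\<open>heavy_vertex_is_sink\<close>). If there is a closed walk of length $2k+1$, the product of the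
$t_v^{w_v}$ along it lies in $I^{(k+1)}$, because every cover meets the walk at least $k+1$ times;
it is not in $I^{k+1}$, because that takes $2k+2$ factors of the form $t_v^{w_v}$ (\<open>underlying_graph_bipartite\<close>).

From (c) to (a): when the heavy vertices are sinks, the generators are the monomials
$t_i^{w_i} t_j^{w_j}$, and a monomial $t^a$ contains $n$ of them as factors exactly when the capacities
$\lfloor a_v / w_v \rfloor$ admit $n$ edges. For a bipartite graph the weighted theorem of Koenig
(\<open>koenig_step\<close>) identifies this with the condition that every vertex cover has capacity at
least $n$. This description of $I^n$ by covers leaves no room for further associated
primes (\<open>assoc_power_eq\<close>).\<close>

section \<open>Monomial ideals\<close>

abbreviation mon :: "'a \<Rightarrow> 'a \<Rightarrow>\<^sub>0 'b::zero_neq_one" where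
  "mon a \<equiv> Poly_Mapping.single a 1"

lemma ring_of_type_algebra_simps [simp]:
  "carrier (ring_of_type_algebra :: 'a::comm_ring_1 ring) = UNIV"
  "monoid.mult (ring_of_type_algebra :: 'a ring) x y = x * y"
  "monoid.one (ring_of_type_algebra :: 'a ring) = 1"
  "ring.zero (ring_of_type_algebra :: 'a ring) = 0"
  "ring.add (ring_of_type_algebra :: 'a ring) x y = x + y"
  by (simp_all add: ring_of_type_algebra_def)

text \<open>Closure under negation comes from multiplication by $-1$.\<close>

lemma (in ring) ideal_by_closure:
  assumes "J \<subseteq> carrier R" "\<zero> \<in> J" "\<And>x y. x \<in> J \<Longrightarrow> y \<in> J \<Longrightarrow> x \<oplus> y \<in> J"
    and "\<And>r x. r \<in> carrier R \<Longrightarrow> x \<in> J \<Longrightarrow> r \<otimes> x \<in> J"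
    and "\<And>r x. r \<in> carrier R \<Longrightarrow> x \<in> J \<Longrightarrow> x \<otimes> r \<in> J"
  shows "ideal J R"
proof (rule idealI)
  show "subgroup J (add_monoid R)"
  proof (rule add.subgroupI)
    fix a assume a: "a \<in> J"
    have "(\<ominus> \<one>) \<otimes> a \<in> J" using assms(4) a by blast
    then show "\<ominus> a \<in> J" using a assms(1) l_minus[of \<one> a] by auto
  qed (use assms in auto)
qed (use assms ring_axioms in auto)

lemma ideal_type_iff:
  "ideal (J :: 'a::comm_ring_1 set) ring_of_type_algebra \<longleftrightarrow>
     0 \<in> J \<and> (\<forall>x\<in>J. \<forall>y\<in>J. x + y \<in> J) \<and> (\<forall>r. \<forall>x\<in>J. r * x \<in> J)" (is "?L \<longleftrightarrow> ?R")
proof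
  assume L: ?L
  then interpret ideal J "ring_of_type_algebra :: 'a ring" .
  show ?R 
    using additive_subgroup.zero_closed[OF is_additive_subgroup]
      additive_subgroup.a_closed[OF is_additive_subgroup] I_l_closed by auto
next
  assume R: ?R
  interpret ring "ring_of_type_algebra :: 'a ring" by (rule ring_from_type_algebra)
  have "x * r \<in> J" if "x \<in> J" for x r using R that by (metis mult.commute)
  then show ?L by (intro ideal_by_closure) (use R in simp_all)
qed

lemma ideal_type_addD:
  "ideal (J :: 'a::comm_ring_1 set) ring_of_type_algebra \<Longrightarrow> x \<in> J \<Longrightarrow> y \<in> J \<Longrightarrow> x + y \<in> J"
  and ideal_type_multD: "ideal J ring_of_type_algebra \<Longrightarrow> x \<in> J \<Longrightarrow> r * x \<in> J"
  by (simp_all add: ideal_type_iff)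

lemma primeideal_type_iff:
  "primeideal (P :: 'a::comm_ring_1 set) ring_of_type_algebra \<longleftrightarrow>
     ideal P ring_of_type_algebra \<and> 1 \<notin> P \<and> (\<forall>x y. x * y \<in> P \<longrightarrow> x \<in> P \<or> y \<in> P)" (is "?L \<longleftrightarrow> ?R")
proof
  assume L: ?L
  then interpret primeideal P "ring_of_type_algebra :: 'a ring" .
  have "1 \<notin> P" using I_notcarr one_imp_carrier by auto
  then show ?R using ideal_axioms I_prime by auto
next
  assume R: ?R
  show ?L
    by (rule primeidealI) (use R cring_from_type_algebra in auto)
qed

lemma poly_mapping_sum_singles:
  "f = (\<Sum>a\<in>Poly_Mapping.keys f. Poly_Mapping.single a (Poly_Mapping.lookup f a))"
  by (rule poly_mapping_eqI)
    (simp add: lookup_sum lookup_single when_def in_keys_iff)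

text \<open>A form of the convolution product with finite sums over the supports, in which single terms can be
dropped.\<close>

lemma lookup_times:
  fixes f g :: "'a::comm_monoid_add \<Rightarrow>\<^sub>0 'b::comm_semiring_0"
  shows "Poly_Mapping.lookup (f * g) a =
    (\<Sum>b\<in>Poly_Mapping.keys f. \<Sum>c\<in>Poly_Mapping.keys g.
       (Poly_Mapping.lookup f b * Poly_Mapping.lookup g c when b + c = a))"
proof -
  have "f * g = (\<Sum>b\<in>Poly_Mapping.keys f. \<Sum>c\<in>Poly_Mapping.keys g.
       Poly_Mapping.single (b + c) (Poly_Mapping.lookup f b * Poly_Mapping.lookup g c))"
    by (subst (1) poly_mapping_sum_singles[of f], subst (1) poly_mapping_sum_singles[of g])
      (simp add: sum_product mult_single)
  then show ?thesis by (simp add: lookup_sum lookup_single)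
qed

definition restr :: "'a set \<Rightarrow> ('a \<Rightarrow>\<^sub>0 'b::comm_monoid_add) \<Rightarrow> 'a \<Rightarrow>\<^sub>0 'b" where
  "restr A f = (\<Sum>a\<in>Poly_Mapping.keys f \<inter> A. Poly_Mapping.single a (Poly_Mapping.lookup f a))"

lemma lookup_restr: "Poly_Mapping.lookup (restr A f) a = (Poly_Mapping.lookup f a when a \<in> A)"
  by (auto simp: restr_def lookup_sum lookup_single when_def in_keys_iff sum.If_cases)

lemma keys_restr [simp]: "Poly_Mapping.keys (restr A f) = Poly_Mapping.keys f \<inter> A"
  by (auto simp: in_keys_iff lookup_restr)

lemma diff_of_sum: "(a::'a::ab_group_add) = b + c \<Longrightarrow> c = a + - b"
  by simp

lemma keys_nonempty: "f \<noteq> 0 \<longleftrightarrow> Poly_Mapping.keys f \<noteq> {}"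
  by simp

lemma restr_split: "restr A f + restr (- A) f = f"
  by (rule poly_mapping_eqI) (simp add: lookup_add lookup_restr when_def)

text \<open>A coefficient of a product sees only those terms of the factors that can contribute to it. This is
the tool for comparing a product with the product of its lowest or of its leading forms.\<close>

lemma lookup_times_restr:
  fixes f g :: "'a::comm_monoid_add \<Rightarrow>\<^sub>0 'b::comm_semiring_0"
  assumes "\<And>b c. b \<in> Poly_Mapping.keys f \<Longrightarrow> c \<in> Poly_Mapping.keys g \<Longrightarrow> b + c = a \<Longrightarrow> b \<in> A \<and> c \<in> B"
  shows "Poly_Mapping.lookup (f * g) a = Poly_Mapping.lookup (restr A f * restr B g) a"
proof -
  have "Poly_Mapping.lookup (restr A f * restr B g) a =
    (\<Sum>b\<in>Poly_Mapping.keys f. \<Sum>c\<in>Poly_Mapping.keys g.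
       (Poly_Mapping.lookup (restr A f) b * Poly_Mapping.lookup (restr B g) c when b + c = a))"
  proof -
    have "(\<Sum>c\<in>Poly_Mapping.keys g \<inter> B.
       (Poly_Mapping.lookup (restr A f) b * Poly_Mapping.lookup (restr B g) c when b + c = a)) = 
      (\<Sum>c\<in>Poly_Mapping.keys g.
       (Poly_Mapping.lookup (restr A f) b * Poly_Mapping.lookup (restr B g) c when b + c = a))" for b
      by (rule sum.mono_neutral_left) (auto simp: lookup_restr)
    then show ?thesis unfolding lookup_times keys_restr
      by (simp only:) (rule sum.mono_neutral_left, auto simp: lookup_restr)
  qed
  also have "\<dots> = Poly_Mapping.lookup (f * g) a"
    unfolding lookup_times
    by (intro sum.cong refl) (auto simp: lookup_restr when_def dest: assms)
  finally show ?thesis by simp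
qed

definition up_closed :: "'a::comm_monoid_add set \<Rightarrow> bool" where
  "up_closed U \<longleftrightarrow> (\<forall>a\<in>U. \<forall>b. a + b \<in> U)"

definition mono_ideal :: "'a set \<Rightarrow> ('a \<Rightarrow>\<^sub>0 'b::zero) set" where
  "mono_ideal U = {f. Poly_Mapping.keys f \<subseteq> U}"

lemma up_closedD: "up_closed U \<Longrightarrow> a \<in> U \<Longrightarrow> a + b \<in> U" "up_closed U \<Longrightarrow> b \<in> U \<Longrightarrow> a + b \<in> U"
  by (auto simp: up_closed_def) (metis add.commute)

lemma mono_ideal_add:
  "f \<in> mono_ideal U \<Longrightarrow> g \<in> mono_ideal U \<Longrightarrow> f + g \<in> mono_ideal U"
  using Poly_Mapping.keys_add[of f g] by (auto simp: mono_ideal_def)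

lemma mono_ideal_zero [simp]: "0 \<in> mono_ideal U"
  by (simp add: mono_ideal_def)

lemma mono_ideal_uminus: "- f \<in> mono_ideal U \<longleftrightarrow> f \<in> mono_ideal U"
  for f :: "'a \<Rightarrow>\<^sub>0 'b::ab_group_add"
  by (simp add: mono_ideal_def subset_iff in_keys_iff)

lemma mono_ideal_mult:
  fixes f g :: "'a::comm_monoid_add \<Rightarrow>\<^sub>0 'b::comm_semiring_0"
  assumes "up_closed U" "g \<in> mono_ideal U"
  shows "f * g \<in> mono_ideal U"
  using assms keys_mult[of f g] up_closedD(2)[OF assms(1)] by (fastforce simp: mono_ideal_def)

lemma mon_in_mono_ideal [simp]: "(mon a :: 'a \<Rightarrow>\<^sub>0 'b::zero_neq_one) \<in> mono_ideal U \<longleftrightarrow> a \<in> U"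
  by (simp add: mono_ideal_def)

lemma ideal_mono_ideal:
  "up_closed U \<Longrightarrow> ideal (mono_ideal U :: ('a::comm_monoid_add \<Rightarrow>\<^sub>0 'b::comm_ring_1) set) ring_of_type_algebra"
  by (auto simp: ideal_type_iff mono_ideal_add mono_ideal_mult)

lemma mono_ideal_subset_iff:
  "(mono_ideal U :: ('a \<Rightarrow>\<^sub>0 'b::zero_neq_one) set) \<subseteq> mono_ideal V \<longleftrightarrow> U \<subseteq> V"
proof
  assume L: "(mono_ideal U :: ('a \<Rightarrow>\<^sub>0 'b) set) \<subseteq> mono_ideal V"
  show "U \<subseteq> V"
  proof
    fix a assume "a \<in> U"
    then have "(mon a :: 'a \<Rightarrow>\<^sub>0 'b) \<in> mono_ideal U" by simp
    then have "(mon a :: 'a \<Rightarrow>\<^sub>0 'b) \<in> mono_ideal V" using L by blast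
    then show "a \<in> V" by simp
  qed
qed (auto simp: mono_ideal_def)

lemma mono_ideal_eq_iff:
  "(mono_ideal U :: ('a \<Rightarrow>\<^sub>0 'b::zero_neq_one) set) = mono_ideal V \<longleftrightarrow> U = V"
  by (metis mono_ideal_subset_iff order_antisym order_refl)

lemma keys_times_mon:
  fixes g :: "'a::cancel_comm_monoid_add \<Rightarrow>\<^sub>0 'b::comm_semiring_1"
  shows "Poly_Mapping.keys (g * mon a) = (\<lambda>b. b + a) ` Poly_Mapping.keys g"
proof -
  have *: "Poly_Mapping.lookup (g * mon a) (b + a) = Poly_Mapping.lookup g b" for b
    by (auto simp: lookup_times when_def in_keys_iff)
  show ?thesis
  proof (intro equalityI subsetI)
    fix c assume c: "c \<in> Poly_Mapping.keys (g * mon a)"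
    then obtain b where "c = b + a" using keys_mult[of g "mon a"] by auto
    then show "c \<in> (\<lambda>b. b + a) ` Poly_Mapping.keys g" using c * by (auto simp: in_keys_iff)
  qed (auto simp: in_keys_iff *)
qed

definition sumset :: "'a::plus set \<Rightarrow> 'a set \<Rightarrow> 'a set" where
  "sumset U V = {a + b |a b. a \<in> U \<and> b \<in> V}"

lemma up_closed_sumset: "up_closed V \<Longrightarrow> up_closed (sumset U V)"
  unfolding up_closed_def sumset_def by clarsimp (metis add.assoc)

lemma ideal_sum_closed:
  "ideal J (ring_of_type_algebra :: 'a::comm_ring_1 ring) \<Longrightarrow> (\<And>x. x \<in> T \<Longrightarrow> f x \<in> J) \<Longrightarrow> sum f T \<in> J"
  by (induction T rule: infinite_finite_induct) (auto simp: ideal_type_iff)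

lemma mono_ideal_subsetI:
  fixes J :: "('a::comm_monoid_add \<Rightarrow>\<^sub>0 'b::comm_ring_1) set"
  assumes J: "ideal J ring_of_type_algebra" and U: "\<And>a. a \<in> U \<Longrightarrow> mon a \<in> J"
  shows "mono_ideal U \<subseteq> J"
proof
  fix f :: "'a \<Rightarrow>\<^sub>0 'b" assume f: "f \<in> mono_ideal U"
  have "Poly_Mapping.single a (Poly_Mapping.lookup f a) \<in> J" if "a \<in> Poly_Mapping.keys f" for a
  proof -
    have "Poly_Mapping.single a (Poly_Mapping.lookup f a) = Poly_Mapping.single 0 (Poly_Mapping.lookup f a) * mon a"
      by (simp add: mult_single)
    moreover have "mon a \<in> J" using that f U by (auto simp: mono_ideal_def)
    ultimately show ?thesis using J by (auto simp: ideal_type_iff)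
  qed
  then have "(\<Sum>a\<in>Poly_Mapping.keys f. Poly_Mapping.single a (Poly_Mapping.lookup f a)) \<in> J"
    by (intro ideal_sum_closed[OF J])
  then show "f \<in> J" using poly_mapping_sum_singles[of f] by simp
qed

text \<open>An ideal with the generators contains all multiples of these monomials, hence every polynomial
supported on such multiples.\<close>

lemma genideal_monomials:
  "Idl\<^bsub>ring_of_type_algebra\<^esub> (mon ` T) =
     (mono_ideal (sumset T UNIV) :: ('a::comm_monoid_add \<Rightarrow>\<^sub>0 'b::comm_ring_1) set)"
proof
  interpret ring "ring_of_type_algebra :: ('a \<Rightarrow>\<^sub>0 'b) ring" by (rule ring_from_type_algebra)
  have "up_closed (sumset T (UNIV :: 'a set))" by (rule up_closed_sumset) (simp add: up_closed_def)
  then have "ideal (mono_ideal (sumset T UNIV) :: ('a \<Rightarrow>\<^sub>0 'b) set) ring_of_type_algebra"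
    by (rule ideal_mono_ideal)
  moreover have "x \<in> sumset T UNIV" if "x \<in> T" for x
    using that unfolding sumset_def by (metis (mono_tags, lifting) UNIV_I add_0_right mem_Collect_eq)
  ultimately show "Idl\<^bsub>ring_of_type_algebra\<^esub> (mon ` T) \<subseteq> (mono_ideal (sumset T UNIV) :: ('a \<Rightarrow>\<^sub>0 'b) set)"
    by (intro genideal_minimal) auto
  have id: "ideal (Idl\<^bsub>ring_of_type_algebra\<^esub> (mon ` T :: ('a \<Rightarrow>\<^sub>0 'b) set)) ring_of_type_algebra"
    by (rule genideal_ideal) simp
  show "(mono_ideal (sumset T UNIV) :: ('a \<Rightarrow>\<^sub>0 'b) set) \<subseteq> Idl\<^bsub>ring_of_type_algebra\<^esub> (mon ` T)"
  proof (rule mono_ideal_subsetI[OF id])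
    fix a assume "a \<in> sumset T UNIV"
    then obtain x b where ab: "x \<in> T" "a = x + b" by (auto simp: sumset_def)
    have "mon x \<in> Idl\<^bsub>ring_of_type_algebra\<^esub> (mon ` T :: ('a \<Rightarrow>\<^sub>0 'b) set)"
      using genideal_self[of "mon ` T"] ab by auto
    then have "mon b * mon x \<in> Idl\<^bsub>ring_of_type_algebra\<^esub> (mon ` T :: ('a \<Rightarrow>\<^sub>0 'b) set)"
      using id by (auto simp: ideal_type_iff)
    then show "mon a \<in> Idl\<^bsub>ring_of_type_algebra\<^esub> (mon ` T :: ('a \<Rightarrow>\<^sub>0 'b) set)"
      by (simp add: mult_single ab add.commute)
  qed
qed

lemma ideal_prod_mono_ideal:
  assumes "up_closed U" "up_closed V"
  shows "(mono_ideal U :: ('a::comm_monoid_add \<Rightarrow>\<^sub>0 'b::comm_ring_1) set) \<cdot>\<^bsub>ring_of_type_algebra\<^esub> mono_ideal V =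
     mono_ideal (sumset U V)"
proof
  let ?P = "(mono_ideal U :: ('a \<Rightarrow>\<^sub>0 'b) set) \<cdot>\<^bsub>ring_of_type_algebra\<^esub> mono_ideal V"
  show "?P \<subseteq> mono_ideal (sumset U V)"
  proof
    fix f assume "f \<in> ?P"
    then show "f \<in> mono_ideal (sumset U V)"
    proof induction
      case (prod i j)
      then show ?case using keys_mult[of i j] by (auto simp: mono_ideal_def sumset_def) blast
    qed (simp add: mono_ideal_add)
  qed
  interpret ring "ring_of_type_algebra :: ('a \<Rightarrow>\<^sub>0 'b) ring" by (rule ring_from_type_algebra)
  have id: "ideal ?P ring_of_type_algebra"
    by (intro ideal_prod_is_ideal ideal_mono_ideal assms)
  show "mono_ideal (sumset U V) \<subseteq> ?P"
  proof (rule mono_ideal_subsetI[OF id])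
    fix a assume "a \<in> sumset U V"
    then obtain u v where "a = u + v" "u \<in> U" "v \<in> V" by (auto simp: sumset_def)
    then have "mon u \<otimes>\<^bsub>ring_of_type_algebra\<^esub> mon v \<in> ?P" by (intro ideal_prod.prod) auto
    then show "mon a \<in> ?P" by (simp add: mult_single \<open>a = u + v\<close>)
  qed
qed

fun sumset_power :: "'a::comm_monoid_add set \<Rightarrow> nat \<Rightarrow> 'a set" where
  "sumset_power U 0 = UNIV"
| "sumset_power U (Suc n) = sumset (sumset_power U n) U"

lemma up_closed_sumset_power: "up_closed U \<Longrightarrow> up_closed (sumset_power U n)"
  by (cases n) (auto intro: up_closed_sumset simp: up_closed_def[of UNIV])

lemma ideal_power_mono_ideal:
  assumes "up_closed U"
  shows "ideal_power ring_of_type_algebra (mono_ideal U :: ('a::comm_monoid_add \<Rightarrow>\<^sub>0 'b::comm_ring_1) set) n =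
     mono_ideal (sumset_power U n)"
proof (induction n)
  case 0
  then show ?case by (simp add: nat_pow_def ideals_set_def mono_ideal_def)
next
  case (Suc n)
  then show ?case
    using ideal_prod_mono_ideal[OF up_closed_sumset_power[OF assms, of n] assms, where 'b = 'b]
    by (simp add: nat_pow_def ideals_set_def)
qed

section \<open>Localization at primes generated by variables\<close>

type_synonym 'v expo = "'v \<Rightarrow>\<^sub>0 nat"

text \<open>The exponents of the monomials in the prime ideal generated by the variables of \<open>C\<close>.\<close>

definition meets :: "'v set \<Rightarrow> 'v expo set" where
  "meets C = {a. Poly_Mapping.keys a \<inter> C \<noteq> {}}"

text \<open>The monomial form of an associated prime: the colon of \<open>U\<close> by one monomial is the set of monomials
that involve a variable of \<open>C\<close>.\<close>

definition assoc :: "'v expo set \<Rightarrow> 'v set set" where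
  "assoc U = {C. \<exists>a. \<forall>b. a + b \<in> U \<longleftrightarrow> b \<in> meets C}"

text \<open>The monomials of the contracted localization at the prime of \<open>C\<close>: the variables outside \<open>C\<close> have
become units.\<close>

definition loc :: "'v set \<Rightarrow> 'v expo set \<Rightarrow> 'v expo set" where
  "loc C U = {a. \<exists>b. b \<notin> meets C \<and> a + b \<in> U}"

lemma keys_add_nat: "Poly_Mapping.keys (a + b :: 'v expo) = Poly_Mapping.keys a \<union> Poly_Mapping.keys b"
  by (auto simp: in_keys_iff lookup_add)

lemma meets_add: "a + b \<in> meets C \<longleftrightarrow> a \<in> meets C \<or> b \<in> meets C"
  by (auto simp: meets_def keys_add_nat)

lemma zero_not_meets [simp]: "0 \<notin> meets C"
  by (simp add: meets_def)

lemma single_meets_iff [simp]: "Poly_Mapping.single v k \<in> meets C \<longleftrightarrow> v \<in> C \<and> k \<noteq> 0"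
  by (auto simp: meets_def)

lemma up_closed_meets: "up_closed (meets C)"
  by (simp add: up_closed_def meets_add)

lemma up_closed_loc: "up_closed U \<Longrightarrow> up_closed (loc C U)"
  unfolding up_closed_def
proof (intro ballI allI)
  fix a b assume U: "\<forall>a\<in>U. \<forall>b. a + b \<in> U" and "a \<in> loc C U"
  then obtain c where c: "c \<notin> meets C" "a + c \<in> U" by (auto simp: loc_def)
  then have "a + c + b \<in> U" using U by blast
  then have "(a + b) + c \<in> U" by (simp add: ac_simps)
  then show "a + b \<in> loc C U" using c by (auto simp: loc_def)
qed

lemma subset_loc: "U \<subseteq> loc C U"
proof
  fix a assume "a \<in> U"
  then have "a + 0 \<in> U" by simp
  then show "a \<in> loc C U" unfolding loc_def using zero_not_meets by blast
qed

lemma loc_cancel: "a + b \<in> loc C U \<Longrightarrow> b \<notin> meets C \<Longrightarrow> a \<in> loc C U"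
proof -
  assume "a + b \<in> loc C U" and b: "b \<notin> meets C"
  then obtain c where "c \<notin> meets C" "a + (b + c) \<in> U" by (auto simp: loc_def add.assoc)
  then show ?thesis using b meets_add[of b c C] unfolding loc_def by blast
qed

lemma meets_subset_iff: "meets C \<subseteq> meets D \<longleftrightarrow> C \<subseteq> D"
proof
  assume L: "meets C \<subseteq> meets D"
  show "C \<subseteq> D"
  proof
    fix v assume "v \<in> C"
    then have "Poly_Mapping.single v (1::nat) \<in> meets C" by simp
    then have "Poly_Mapping.single v (1::nat) \<in> meets D" using L by blast
    then show "v \<in> D" by simp
  qed
qed (auto simp: meets_def)

lemma meets_split:
  assumes "b \<in> meets C"
  obtains v c where "v \<in> C" "b = Poly_Mapping.single v 1 + c"
proof -
  obtain v where v: "v \<in> C" "Poly_Mapping.lookup b v \<noteq> 0"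
    using assms by (auto simp: meets_def in_keys_iff)
  have "b = Poly_Mapping.single v 1 + (b - Poly_Mapping.single v 1)"
    by (rule poly_mapping_eqI) (use v in \<open>auto simp: lookup_add lookup_minus lookup_single when_def\<close>)
  then show ?thesis using v that by blast
qed

abbreviation var_prime :: "'v set \<Rightarrow> ('v, 'k::field) mpoly set" where
  "var_prime C \<equiv> mono_ideal (meets C)"

lemma var_prime_subset_iff:
  "(var_prime C :: ('v, 'k::field) mpoly set) \<subseteq> var_prime D \<longleftrightarrow> C \<subseteq> D"
  by (simp add: mono_ideal_subset_iff meets_subset_iff)

lemma var_prime_eq_iff:
  "(var_prime C :: ('v, 'k::field) mpoly set) = var_prime D \<longleftrightarrow> C = D"
  by (metis order_antisym order_refl var_prime_subset_iff)

text \<open>An element outside the prime of \<open>C\<close> is a nonzerodivisor modulo the localized ideal. Discard the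
terms of $f$ that lie in the localized ideal and grade by the degree in the variables of \<open>C\<close>. The part
of lowest degree of the product is the product of the degree zero part of $s$ and of the lowest part of
$f$; it is nonzero in a domain, so one of the remaining terms of $f$ lies in the localized ideal after all.\<close>

lemma nonzerodivisor_mod_loc:
  fixes f s :: "('v::{finite, linorder}, 'k::field) mpoly"
  assumes U: "up_closed U" and s: "s \<notin> var_prime C" and sf: "s * f \<in> mono_ideal U"
  shows "f \<in> mono_ideal (loc C U)"
proof (rule ccontr)
  let ?V = "loc C U"
  define deg where "deg a = (\<Sum>v\<in>C. Poly_Mapping.lookup a v)" for a :: "'v expo"
  have deg_add: "deg (a + b) = deg a + deg b" for a b
    by (simp add: deg_def lookup_add sum.distrib)
  have deg_0: "deg a = 0 \<longleftrightarrow> a \<notin> meets C" for a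
    by (auto simp: deg_def meets_def in_keys_iff)
  assume f: "f \<notin> mono_ideal ?V"
  define f1 where "f1 = restr (- ?V) f"
  have f1: "f1 \<noteq> 0" using f by (auto simp: f1_def keys_nonempty mono_ideal_def simp del: keys_eq_empty)
  have V: "up_closed ?V" by (rule up_closed_loc[OF U])
  have "s * f = s * restr ?V f + s * f1"
    by (simp only: f1_def distrib_left[symmetric] restr_split)
  then have eq: "s * f1 = s * f + - (s * restr ?V f)" by (rule diff_of_sum)
  have in1: "- (s * restr ?V f) \<in> mono_ideal ?V"
    unfolding mono_ideal_uminus by (rule mono_ideal_mult[OF V]) (simp add: mono_ideal_def)
  have in2: "s * f \<in> mono_ideal ?V"
    using sf subset_loc[of U C] unfolding mono_ideal_def mem_Collect_eq by (rule order_trans)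
  have sf1: "s * f1 \<in> mono_ideal ?V"
    unfolding eq by (rule mono_ideal_add[OF in2 in1])
  \<comment> \<open>The part of lowest degree of the remaining terms, and the part of $s$ that avoids \<open>C\<close>.\<close>
  define d where "d = Min (deg ` Poly_Mapping.keys f1)"
  define f2 where "f2 = restr {a. deg a = d} f1"
  define s0 where "s0 = restr (- meets C) s"
  have ne: "deg ` Poly_Mapping.keys f1 \<noteq> {}" using f1 by simp
  have d_le: "d \<le> deg a" if "a \<in> Poly_Mapping.keys f1" for a
    using that by (simp add: d_def)
  have "d \<in> deg ` Poly_Mapping.keys f1" using ne unfolding d_def by (intro Min_in) auto
  then have "f2 \<noteq> 0" by (auto simp: f2_def keys_nonempty simp del: keys_eq_empty)
  moreover have "s0 \<noteq> 0" using s by (auto simp: s0_def keys_nonempty mono_ideal_def simp del: keys_eq_empty)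
  ultimately have "s0 * f2 \<noteq> 0" by simp
  then obtain a where a: "a \<in> Poly_Mapping.keys (s0 * f2)" 
    unfolding keys_nonempty by blast
  then obtain b c where bc: "a = b + c" "b \<in> Poly_Mapping.keys s0" "c \<in> Poly_Mapping.keys f2"
    using keys_mult[of s0 f2] by auto
  have "deg a = d" using bc deg_0[of b] by (auto simp: s0_def f2_def deg_add)
  then have "b' \<in> - meets C \<and> c' \<in> {a. deg a = d}"
    if "b' \<in> Poly_Mapping.keys s" "c' \<in> Poly_Mapping.keys f1" "b' + c' = a" for b' c'
    using d_le[OF that(2)] that(3) deg_add[of b' c'] deg_0[of b'] by auto
  then have "Poly_Mapping.lookup (s * f1) a = Poly_Mapping.lookup (s0 * f2) a"
    unfolding s0_def f2_def by (rule lookup_times_restr)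
  then have "a \<in> Poly_Mapping.keys (s * f1)" using a by (simp add: in_keys_iff)
  then have "c + b \<in> ?V" using sf1 bc by (auto simp: mono_ideal_def add.commute)
  moreover have "b \<notin> meets C" "c \<notin> ?V" using bc by (auto simp: s0_def f2_def f1_def)
  ultimately show False by (metis loc_cancel)
qed

text \<open>The up-closed set absorbs the multipliers of the other elements, so their sum serves all at once.\<close>

lemma common_multiplier:
  fixes U :: "'v::finite expo set"
  assumes U: "up_closed U" and Y: "finite Y" "Y \<subseteq> loc C U"
  shows "\<exists>b. b \<notin> meets C \<and> (\<forall>a\<in>Y. a + b \<in> U)"
  using Y
proof (induction Y)
    case empty
    show ?case by (rule exI[of _ 0]) simp
  next
    case (insert x Y)
    then obtain b c where b: "b \<notin> meets C" "\<forall>a\<in>Y. a + b \<in> U" and c: "c \<notin> meets C" "x + c \<in> U"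
      by (auto simp: loc_def)
    have "a + (b + c) \<in> U" if "a \<in> Y" for a
      using up_closedD(1)[OF U, of "a + b" c] b that by (simp add: add.assoc)
    moreover have "x + (b + c) \<in> U"
      using up_closedD(1)[OF U c(2), of b] by (simp add: ac_simps)
    ultimately show ?case using b c by (intro exI[of _ "b + c"]) (auto simp: meets_add)
qed

lemma denominator_loc:
  fixes f :: "('v::finite, 'k::field) mpoly"
  assumes U: "up_closed U" and f: "f \<in> mono_ideal (loc C U)"
  shows "\<exists>s. s \<notin> var_prime C \<and> s * f \<in> mono_ideal U"
proof -
  have "Poly_Mapping.keys f \<subseteq> loc C U" using f by (simp add: mono_ideal_def)
  then obtain b where "b \<notin> meets C" "\<forall>a\<in>Poly_Mapping.keys f. a + b \<in> U"
    using common_multiplier[OF U finite_keys] by blast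
  then have "mon b \<notin> (var_prime C :: ('v, 'k) mpoly set) \<and> f * mon b \<in> mono_ideal U"
    by (auto simp: mono_ideal_def keys_times_mon)
  then show ?thesis using mult.commute[of f "mon b"] by metis
qed

lemma loc_meets: "loc C (meets C) = meets C"
  using subset_loc[of "meets C" C] by (auto simp: loc_def meets_add)

text \<open>The set \<open>meets C\<close> is its own localization at \<open>C\<close>, so primality is an instance of
\<open>nonzerodivisor_mod_loc\<close>.\<close>

lemma primeideal_var_prime:
  "primeideal (var_prime C :: ('v::{finite, linorder}, 'k::field) mpoly set) ring_of_type_algebra"
  unfolding primeideal_type_iff
proof (intro conjI allI impI)
  show "ideal (var_prime C :: ('v, 'k) mpoly set) ring_of_type_algebra"
    by (rule ideal_mono_ideal[OF up_closed_meets])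
  show "1 \<notin> (var_prime C :: ('v, 'k) mpoly set)"
    by (simp add: mono_ideal_def)
  fix x y :: "('v, 'k) mpoly" assume "x * y \<in> var_prime C"
  then show "x \<in> var_prime C \<or> y \<in> var_prime C"
    using nonzerodivisor_mod_loc[OF up_closed_meets, of x C y C] by (auto simp: loc_meets)
qed

section \<open>Associated primes of monomial ideals\<close>

lemma restr_singleton: "restr {u} f = Poly_Mapping.single u (Poly_Mapping.lookup f u)"
  by (rule poly_mapping_eqI) (auto simp: lookup_restr lookup_single when_def)

lemma lookup_times_Max:
  fixes f g :: "('v::{finite, linorder}, 'k::field) mpoly"
  assumes "f \<noteq> 0" "g \<noteq> 0"
  shows "Max (Poly_Mapping.keys f) + Max (Poly_Mapping.keys g) \<in> Poly_Mapping.keys (f * g)"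
proof -
  define u m where "u = Max (Poly_Mapping.keys f)" and "m = Max (Poly_Mapping.keys g)"
  have in_keys: "u \<in> Poly_Mapping.keys f" "m \<in> Poly_Mapping.keys g"
    using assms unfolding u_def m_def by (auto intro!: Max_in)
  have max: "\<And>b. b \<in> Poly_Mapping.keys f \<Longrightarrow> b \<le> u" "\<And>c. c \<in> Poly_Mapping.keys g \<Longrightarrow> c \<le> m"
    unfolding u_def m_def by (rule Max.coboundedI[OF finite_keys], assumption)+
  have "b \<in> {u} \<and> c \<in> {m}"
    if bc: "b \<in> Poly_Mapping.keys f" "c \<in> Poly_Mapping.keys g" "b + c = u + m" for b c
  proof -
    have "\<not> b < u"
    proof
      assume "b < u"
      from add_less_le_mono[OF this max(2)[OF bc(2)]] bc(3) show False by simp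
    qed
    then have "b = u" using max(1)[OF bc(1)] by simp
    then show ?thesis using bc(3) by simp
  qed
  then have "Poly_Mapping.lookup (f * g) (u + m) = Poly_Mapping.lookup (restr {u} f * restr {m} g) (u + m)"
    by (rule lookup_times_restr)
  also have "\<dots> \<noteq> 0" using in_keys by (simp add: restr_singleton mult_single in_keys_iff)
  finally have "u + m \<in> Poly_Mapping.keys (f * g)" unfolding in_keys_iff .
  then show ?thesis unfolding u_def m_def .
qed

text \<open>Induction on the number of terms of $f$. If the leading monomial $u$ of $g$ were outside $P$,
multiplying $f$ by $u$ would not change the colon ideal. But the leading term of $gf$ lies in the monomial
ideal, so the leading term of $uf$ can be dropped, which leaves fewer terms.\<close>

lemma colon_prime_contains_leading_monomial:
  fixes f g :: "('v::{finite, linorder}, 'k::field) mpoly"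
  assumes U: "up_closed U" and P: "primeideal P ring_of_type_algebra"
    and colon: "P = colon ring_of_type_algebra (mono_ideal U) f" and g: "g \<in> P" "g \<noteq> 0"
  shows "mon (Max (Poly_Mapping.keys g)) \<in> P"
  using colon
proof (induction "card (Poly_Mapping.keys f)" arbitrary: f rule: less_induct)
  case less
  let ?J = "mono_ideal U :: ('v, 'k) mpoly set" and ?u = "Max (Poly_Mapping.keys g)"
  have P': "ideal P ring_of_type_algebra" "1 \<notin> P" "\<And>x y. x * y \<in> P \<Longrightarrow> x \<in> P \<or> y \<in> P"
    using P by (auto simp: primeideal_type_iff)
  have mem: "h \<in> P \<longleftrightarrow> h * f \<in> ?J" for h using less.prems by (simp add: colon_def)
  have f0: "f \<noteq> 0" using mem[of 1] P'(2) by auto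
  show ?case
  proof (rule ccontr)
    assume u: "mon ?u \<notin> P"
    let ?m = "Max (Poly_Mapping.keys f)"
    have m: "?m \<in> Poly_Mapping.keys f" using f0 by (auto intro!: Max_in)
    have um: "?u + ?m \<in> U"
      using lookup_times_Max[OF g(2) f0] mem[of g] g(1) by (auto simp: mono_ideal_def)
    define r where "r = restr {?m} f"
    define f' where "f' = restr (- {?m}) f * mon ?u"
    have J: "ideal ?J ring_of_type_algebra" by (rule ideal_mono_ideal[OF U])
    have r: "r * mon ?u \<in> ?J" using um m by (simp add: r_def mono_ideal_def keys_times_mon add.commute)
    have "h * f' \<in> ?J \<longleftrightarrow> h \<in> P" for h
    proof -
      have "h * (f * mon ?u) = h * (r * mon ?u) + h * f'"
        unfolding r_def f'_def distrib_left[symmetric] distrib_right[symmetric] restr_split ..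
      moreover have hr: "h * (r * mon ?u) \<in> ?J" by (intro mono_ideal_mult U r)
      ultimately have "h * f' \<in> ?J \<longleftrightarrow> h * (f * mon ?u) \<in> ?J"
        by (metis add_minus_cancel mono_ideal_add mono_ideal_uminus)
      also have "\<dots> \<longleftrightarrow> h * mon ?u \<in> P" by (simp add: mem mult_ac)
      also have "\<dots> \<longleftrightarrow> h \<in> P"
        using P'(3)[of h "mon ?u"] u ideal_type_multD[OF P'(1), of h "mon ?u"]
        by (metis mult.commute)
      finally show ?thesis .
    qed
    then have "P = colon ring_of_type_algebra ?J f'" by (auto simp: colon_def)
    moreover have "card (Poly_Mapping.keys f') < card (Poly_Mapping.keys f)"
    proof -
      have "card (Poly_Mapping.keys f') \<le> card (Poly_Mapping.keys f \<inter> - {?m})"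
        unfolding f'_def keys_times_mon keys_restr by (rule card_image_le) simp
      also have "\<dots> < card (Poly_Mapping.keys f)" using m by (intro psubset_card_mono) auto
      finally show ?thesis .
    qed
    ultimately have "mon ?u \<in> P" using less.hyps by blast
    then show False using u by simp
  qed
qed

text \<open>Subtract the leading term, which lies in $P$, and repeat.\<close>

lemma colon_prime_contains_monomials:
  fixes f g :: "('v::{finite, linorder}, 'k::field) mpoly"
  assumes U: "up_closed U" and P: "primeideal P ring_of_type_algebra"
    and colon: "P = colon ring_of_type_algebra (mono_ideal U) f"
    and g: "g \<in> P" "a \<in> Poly_Mapping.keys g"
  shows "mon a \<in> P"
  using g
proof (induction "card (Poly_Mapping.keys g)" arbitrary: g rule: less_induct)
  case less
  let ?u = "Max (Poly_Mapping.keys g)"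
  have g0: "g \<noteq> 0" using less.prems by auto
  have id: "ideal P ring_of_type_algebra" using P by (simp add: primeideal_type_iff)
  have u: "mon ?u \<in> P"
    by (rule colon_prime_contains_leading_monomial[OF U P colon less.prems(1) g0])
  have uk: "?u \<in> Poly_Mapping.keys g" using g0 by (auto intro!: Max_in)
  show ?case
  proof (cases "a = ?u")
    case False
    let ?g = "restr (- {?u}) g"
    have "restr {?u} g = Poly_Mapping.single 0 (Poly_Mapping.lookup g ?u) * mon ?u"
      using uk by (simp add: restr_def mult_single)
    then have "restr {?u} g \<in> P" using u id by (simp add: ideal_type_iff)
    then have "g + (- 1) * restr {?u} g \<in> P"
      by (intro ideal_type_addD[OF id] ideal_type_multD[OF id] less.prems(1))
    moreover have "?g = g + - restr {?u} g"
      by (rule diff_of_sum[OF restr_split[symmetric]])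
    ultimately have "?g \<in> P" by simp
    moreover have "card (Poly_Mapping.keys ?g) < card (Poly_Mapping.keys g)"
      using uk by (intro psubset_card_mono) auto
    ultimately show ?thesis using less.hyps[of ?g] less.prems False by simp
  qed (use u in simp)
qed

text \<open>A prime colon ideal contains the monomials of its elements, so it is generated by variables. If each
term of $f$ could be moved into the monomial ideal by a monomial outside $P$, a common multiplier would
move all of $f$; hence some single term of $f$ already has the colon ideal $P$.\<close>

theorem Ass_mono_ideal:
  fixes U :: "'v::{finite, linorder} expo set"
  assumes U: "up_closed U"
  shows "Ass ring_of_type_algebra (mono_ideal U :: ('v, 'k::field) mpoly set) = var_prime ` assoc U"
proof (intro equalityI subsetI)
  let ?J = "mono_ideal U :: ('v, 'k) mpoly set"
  fix P assume "P \<in> Ass ring_of_type_algebra ?J"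
  then obtain f where P: "primeideal P ring_of_type_algebra"
    and colon: "P = colon ring_of_type_algebra ?J f" by (auto simp: Ass_def)
  have P': "ideal P ring_of_type_algebra" "1 \<notin> P" "\<And>x y. x * y \<in> P \<Longrightarrow> x \<in> P \<or> y \<in> P"
    using P by (auto simp: primeideal_type_iff)
  define C where "C = {v. mon (Poly_Mapping.single v 1) \<in> P}"
  have mon_iff: "mon a \<in> P \<longleftrightarrow> a \<in> meets C" for a
  proof
    assume "a \<in> meets C"
    then obtain v c where v: "v \<in> C" "a = Poly_Mapping.single v 1 + c" by (rule meets_split)
    have "mon a = mon c * (mon (Poly_Mapping.single v 1) :: ('v, 'k) mpoly)"
      by (simp add: mult_single v(2) add.commute)
    then show "mon a \<in> P" using v(1) ideal_type_multD[OF P'(1)] by (simp add: C_def)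
  next
    have *: "\<exists>v\<in>Poly_Mapping.keys a. v \<in> C" if "mon a \<in> P" for a
      using that
    proof (induction "\<Sum>v\<in>UNIV. Poly_Mapping.lookup a v" arbitrary: a)
      case 0
      then have "a = 0" by (intro poly_mapping_eqI) simp
      then show ?case using 0 P'(2) by simp
    next
      case (Suc n)
      then have "\<exists>v. Poly_Mapping.lookup a v \<noteq> 0" by (metis sum.neutral nat.distinct(1))
      then obtain v where v: "Poly_Mapping.lookup a v \<noteq> 0" by blast
      define b where "b = a - Poly_Mapping.single v 1"
      have ab: "a = b + Poly_Mapping.single v 1" unfolding b_def
        by (rule poly_mapping_eqI) (use v in \<open>auto simp: lookup_add lookup_minus lookup_single when_def\<close>)
      have "mon a = mon b * (mon (Poly_Mapping.single v 1) :: ('v, 'k) mpoly)"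
        by (subst ab) (simp add: mult_single)
      then have "mon b \<in> P \<or> v \<in> C" using Suc.prems P'(3) by (auto simp: C_def)
      moreover have "n = (\<Sum>v\<in>UNIV. Poly_Mapping.lookup b v)"
        using Suc.hyps(2) unfolding ab by (simp add: lookup_add lookup_single when_def sum.distrib)
      ultimately show ?case using Suc.hyps(1)[of b] v by (auto simp: ab keys_add_nat)
    qed
    then show "mon a \<in> P \<Longrightarrow> a \<in> meets C" by (auto simp: meets_def)
  qed
  have PC: "P = var_prime C"
  proof
    show "P \<subseteq> var_prime C"
      using colon_prime_contains_monomials[OF U P colon] mon_iff by (auto simp: mono_ideal_def)
    show "var_prime C \<subseteq> P" by (rule mono_ideal_subsetI[OF P'(1)]) (simp add: mon_iff)
  qed
  have mem: "h \<in> P \<longleftrightarrow> h * f \<in> ?J" for h using colon by (simp add: colon_def)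
  have "\<exists>a\<in>Poly_Mapping.keys f. a \<notin> loc C U"
  proof (rule ccontr)
    assume "\<not> ?thesis"
    then have "f \<in> mono_ideal (loc C U)" by (auto simp: mono_ideal_def)
    then show False using denominator_loc[OF U] mem PC by blast
  qed
  then obtain a where a: "a \<in> Poly_Mapping.keys f" "a \<notin> loc C U" by blast
  have "a + b \<in> U" if "b \<in> meets C" for b
  proof -
    have "f * mon b \<in> ?J" using that mon_iff mem by (simp add: mult.commute)
    then show ?thesis using a(1) by (auto simp: mono_ideal_def keys_times_mon)
  qed
  then have "C \<in> assoc U" using a(2) by (auto simp: assoc_def loc_def)
  then show "P \<in> var_prime ` assoc U" using PC by blast
next
  let ?J = "mono_ideal U :: ('v, 'k) mpoly set"
  fix P :: "('v, 'k) mpoly set" assume "P \<in> var_prime ` assoc U"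
  then obtain C a where P: "P = var_prime C" and a: "\<And>b. a + b \<in> U \<longleftrightarrow> b \<in> meets C"
    by (auto simp: assoc_def)
  have "colon ring_of_type_algebra ?J (mon a) = P"
    unfolding P colon_def by (auto simp: mono_ideal_def keys_times_mon a[symmetric] add.commute)
  then show "P \<in> Ass ring_of_type_algebra ?J"
    using primeideal_var_prime[of C] P by (auto simp: Ass_def)
qed

section \<open>Symbolic powers of monomial ideals\<close>

lemma fract_denominators:
  fixes P :: "'a::idom set"
  assumes P: "primeideal P ring_of_type_algebra"
  shows "0 \<in> P" "1 \<notin> P" "b \<notin> P \<Longrightarrow> d \<notin> P \<Longrightarrow> b * d \<notin> P" "b \<notin> P \<Longrightarrow> b \<noteq> 0"
  using P by (auto simp: primeideal_type_iff ideal_type_iff)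

lemma ring_localization:
  fixes P :: "'a::idom set"
  assumes P: "primeideal P ring_of_type_algebra"
  shows "ring (localization P)"
proof -
  note d = fract_denominators[OF P]
  interpret F: ring "ring_of_type_algebra :: 'a fract ring" by (rule ring_from_type_algebra)
  have neg: "\<ominus>\<^bsub>ring_of_type_algebra\<^esub> x = - x" for x :: "'a fract"
    by (rule F.minus_equality) simp_all
  have "subring {Fract a b |a b. b \<notin> P} ring_of_type_algebra"
  proof (rule F.subringI)
    fix x y assume "x \<in> {Fract a b |a b. b \<notin> P}" "y \<in> {Fract a b |a b. b \<notin> P}"
    then obtain a b c e where xy: "x = Fract a b" "b \<notin> P" "y = Fract c e" "e \<notin> P" by blast
    show "x \<otimes>\<^bsub>ring_of_type_algebra\<^esub> y \<in> {Fract a b |a b. b \<notin> P}"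
      using xy d(3)[of b e] by auto
    show "x \<oplus>\<^bsub>ring_of_type_algebra\<^esub> y \<in> {Fract a b |a b. b \<notin> P}"
      using xy d(3)[of b e] d(4)[of b] d(4)[of e] by auto
  next
    fix x assume "x \<in> {Fract a b |a b. b \<notin> P}"
    then obtain a b where x: "x = Fract a b" "b \<notin> P" by blast
    then have "- x = Fract (- a) b" by simp
    then show "\<ominus>\<^bsub>ring_of_type_algebra\<^esub> x \<in> {Fract a b |a b. b \<notin> P}" using x(2) neg by auto
  next
    show "\<one>\<^bsub>ring_of_type_algebra\<^esub> \<in> {Fract a b |a b. b \<notin> P}"
      using d(2) by (auto simp: One_fract_def)
  qed simp
  then show ?thesis unfolding localization_def by (rule F.subring_is_ring)
qed

lemma localization_simps [simp]:
  "carrier (localization P) = {Fract a b |a b. b \<notin> P}"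
  "monoid.mult (localization P) x y = x * y"
  "ring.add (localization P) x y = x + y"
  "ring.zero (localization P) = 0"
  by (simp_all add: localization_def)

lemma extended_ideal_eq:
  fixes P J :: "'a::idom set"
  assumes P: "primeideal P ring_of_type_algebra" and J: "ideal J ring_of_type_algebra"
  shows "extended_ideal P J = {Fract a b |a b. a \<in> J \<and> b \<notin> P}" (is "_ = ?K")
proof
  note d = fract_denominators[OF P]
  interpret L: ring "localization P" by (rule ring_localization[OF P])
  have J0: "0 \<in> J" using J by (simp add: ideal_type_iff)
  have sub: "to_fract ` J \<subseteq> ?K" using d(2) by (auto simp: to_fract_def)
  have mult: "r * x \<in> ?K" if rx: "r \<in> {Fract a b |a b. b \<notin> P}" "x \<in> ?K" for r x
  proof -
    obtain a b c e where "r = Fract a b" "b \<notin> P" "x = Fract c e" "c \<in> J" "e \<notin> P"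
      using rx by blast
    then show ?thesis using d(3)[of b e] ideal_type_multD[OF J, of c a] by auto
  qed
  have "ideal ?K (localization P)"
  proof (rule L.ideal_by_closure)
    fix x y assume "x \<in> ?K" "y \<in> ?K"
    then obtain a b c e where xy: "x = Fract a b" "a \<in> J" "b \<notin> P" "y = Fract c e" "c \<in> J" "e \<notin> P"
      by blast
    have "e * a + b * c \<in> J" using xy by (intro ideal_type_addD[OF J] ideal_type_multD[OF J])
    then have "a * e + c * b \<in> J" by (simp add: mult.commute)
    then show "x \<oplus>\<^bsub>localization P\<^esub> y \<in> ?K"
      using xy d(3)[of b e] d(4)[of b] d(4)[of e] by auto
  next
    show "\<zero>\<^bsub>localization P\<^esub> \<in> ?K" using J0 d(2) by (auto simp: Zero_fract_def)
  next
    fix r x assume "r \<in> carrier (localization P)" "x \<in> ?K"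
    then have "r * x \<in> ?K" using mult by simp
    then show "r \<otimes>\<^bsub>localization P\<^esub> x \<in> ?K" "x \<otimes>\<^bsub>localization P\<^esub> r \<in> ?K"
      by (simp_all only: localization_simps mult.commute)
  qed auto
  then show "extended_ideal P J \<subseteq> ?K"
    unfolding extended_ideal_def using sub by (rule L.genideal_minimal)
  have tc: "to_fract ` J \<subseteq> carrier (localization P)" using sub by auto
  show "?K \<subseteq> extended_ideal P J"
  proof
    fix x assume "x \<in> ?K"
    then obtain a b where x: "x = Fract a b" "a \<in> J" "b \<notin> P" by blast
    have "to_fract a \<in> extended_ideal P J"
      unfolding extended_ideal_def using L.genideal_self[OF tc] x(2) by auto
    moreover have "Fract 1 b \<in> carrier (localization P)" using x by auto
    ultimately have "Fract 1 b \<otimes>\<^bsub>localization P\<^esub> to_fract a \<in> extended_ideal P J"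
      using ideal.I_l_closed[OF L.genideal_ideal[OF tc]] unfolding extended_ideal_def by blast
    then show "x \<in> extended_ideal P J" by (simp add: x to_fract_def)
  qed
qed

text \<open>The contraction of an extended ideal by means of denominators, without fractions.\<close>

lemma to_fract_in_extended_ideal_iff:
  fixes P J :: "'a::idom set"
  assumes P: "primeideal P ring_of_type_algebra" and J: "ideal J ring_of_type_algebra"
  shows "to_fract f \<in> extended_ideal P J \<longleftrightarrow> (\<exists>s. s \<notin> P \<and> s * f \<in> J)"
proof
  note d = fract_denominators[OF P]
  assume "to_fract f \<in> extended_ideal P J"
  then obtain a b where ab: "Fract f 1 = Fract a b" "a \<in> J" "b \<notin> P"
    unfolding extended_ideal_eq[OF P J] to_fract_def by blast
  have "f * b = a" using ab d(4)[of b] by (simp add: eq_fract)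
  then have "b * f \<in> J" using ab by (simp add: mult.commute)
  then show "\<exists>s. s \<notin> P \<and> s * f \<in> J" using ab by blast
next
  note d = fract_denominators[OF P]
  assume "\<exists>s. s \<notin> P \<and> s * f \<in> J"
  then obtain s where s: "s \<notin> P" "s * f \<in> J" by blast
  have "to_fract f = Fract (s * f) s" using d(4)[OF s(1)] by (simp add: to_fract_def eq_fract)
  then show "to_fract f \<in> extended_ideal P J" unfolding extended_ideal_eq[OF P J] using s by blast
qed

lemma contraction_mono_ideal:
  fixes U :: "'v::{finite, linorder} expo set"
  assumes U: "up_closed U"
  shows "to_fract -` extended_ideal (var_prime C) (mono_ideal U :: ('v, 'k::field) mpoly set) =
    mono_ideal (loc C U)"
proof -
  have "(\<exists>s. s \<notin> var_prime C \<and> s * f \<in> mono_ideal U) \<longleftrightarrow> f \<in> mono_ideal (loc C U)"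
    for f :: "('v, 'k) mpoly"
    using nonzerodivisor_mod_loc[OF U] denominator_loc[OF U] by blast
  then show ?thesis
    using to_fract_in_extended_ideal_iff[OF primeideal_var_prime ideal_mono_ideal[OF U]]
    by (auto simp: vimage_def)
qed

lemma embedded_prime_mono_ideal_iff:
  fixes U :: "'v::{finite, linorder} expo set"
  assumes U: "up_closed U"
  shows "(\<exists>P. embedded_prime ring_of_type_algebra (mono_ideal U :: ('v, 'k::field) mpoly set) P) \<longleftrightarrow>
    (\<exists>C\<in>assoc U. \<exists>D\<in>assoc U. D \<subset> C)"
  unfolding embedded_prime_def Ass_mono_ideal[OF U] psubset_eq
  by (auto simp: var_prime_subset_iff var_prime_eq_iff) 

text \<open>Without embedded primes every associated prime is minimal, so the intersection that defines the
symbolic power runs over all of \<open>assoc U\<close>.\<close>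

lemma symbolic_power_mono_ideal:
  fixes U :: "'v::{finite, linorder} expo set"
  assumes U: "up_closed U"
    and unmixed: "\<not> (\<exists>P. embedded_prime ring_of_type_algebra (mono_ideal U :: ('v, 'k::field) mpoly set) P)"
  shows "symbolic_power (mono_ideal U :: ('v, 'k) mpoly set) n =
    mono_ideal (\<Inter>C\<in>assoc U. loc C (sumset_power U n))"
proof -
  have "minimal_primes ring_of_type_algebra (mono_ideal U :: ('v, 'k) mpoly set) = var_prime ` assoc U"
    using unmixed Ass_mono_ideal[OF U] by (auto simp: minimal_primes_def)
  then show ?thesis
    unfolding symbolic_power_def ideal_power_mono_ideal[OF U]
    by (simp add: contraction_mono_ideal up_closed_sumset_power[OF U]) (auto simp: mono_ideal_def)
qed

section \<open>Primary decomposition of up-closed sets\<close>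

text \<open>If $a$ is a socle element relative to a localization, one common multiplier clears all the
denominators and yields a monomial whose colon is exactly \<open>meets C\<close>.\<close>

lemma assoc_of_socle:
  fixes U :: "'v::finite expo set"
  assumes U: "up_closed U" and D: "C \<subseteq> D" and a: "a \<notin> loc C (loc D U)"
    and socle: "\<And>v. v \<in> C \<Longrightarrow> a + Poly_Mapping.single v 1 \<in> loc D U"
  shows "C \<in> assoc U"
proof -
  have sub: "(\<lambda>v. a + Poly_Mapping.single v 1) ` C \<subseteq> loc D U" using socle by blast
  obtain b where b: "b \<notin> meets D"
    "\<forall>c \<in> (\<lambda>v. a + Poly_Mapping.single v 1) ` C. c + b \<in> U"
    using common_multiplier[OF U finite_imageI[OF finite] sub] by auto
  have "a + b + c \<in> U \<longleftrightarrow> c \<in> meets C" for c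
  proof
    assume "c \<in> meets C"
    then obtain v d where v: "v \<in> C" "c = Poly_Mapping.single v 1 + d" by (rule meets_split)
    have "a + Poly_Mapping.single v 1 + b + d \<in> U" by (rule up_closedD(1)[OF U bspec[OF b(2) imageI[OF v(1)]]])
    then show "a + b + c \<in> U" by (simp add: v ac_simps)
  next
    assume "a + b + c \<in> U"
    then have "(a + c) + b \<in> loc D U" using subset_loc[of U D] by (auto simp: ac_simps)
    then have "a + c \<in> loc D U" using b(1) by (rule loc_cancel)
    then show "c \<in> meets C" using a unfolding loc_def[of C] by blast
  qed
  then show ?thesis unfolding assoc_def by blast
qed

lemma loc_UNIV: "loc UNIV U = (U :: 'v expo set)"
proof -
  have "b \<notin> meets UNIV \<longleftrightarrow> b = 0" for b :: "'v expo" by (simp add: meets_def)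
  then show ?thesis by (simp add: loc_def)
qed

lemma loc_loc: "C \<subseteq> D \<Longrightarrow> loc C (loc D U) = loc C U"
proof
  assume "C \<subseteq> D"
  then have CD: "b \<notin> meets C" if "b \<notin> meets D" for b using that meets_subset_iff[of C D] by blast
  show "loc C (loc D U) \<subseteq> loc C U"
  proof
    fix a assume "a \<in> loc C (loc D U)"
    then obtain b c where bc: "b \<notin> meets C" "c \<notin> meets D" "a + b + c \<in> U" by (auto simp: loc_def)
    then have "b + c \<notin> meets C" using CD[of c] meets_add[of b c C] by blast
    moreover have "a + (b + c) \<in> U" using bc by (simp add: add.assoc)
    ultimately show "a \<in> loc C U" unfolding loc_def by blast
  qed
  show "loc C U \<subseteq> loc C (loc D U)"
    using subset_loc[of U D] by (auto simp: loc_def[of C])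
qed

text \<open>Among the multiples of $a$, choose one that stays outside the localization at a set \<open>C\<close> of the least
possible size. Minimality makes each variable of \<open>C\<close> nilpotent on it, so there is a multiple of maximal
degree in \<open>C\<close> that still stays outside; this is a socle element, and \<open>C\<close> is associated.\<close>

theorem assoc_separates:
  fixes U :: "'v::finite expo set"
  assumes U: "up_closed U" and a: "a \<notin> U"
  shows "\<exists>C\<in>assoc U. a \<notin> loc C U"
proof -
  define Q where "Q C \<longleftrightarrow> (\<exists>d. a + d \<notin> loc C U)" for C
  have "a + 0 \<notin> loc UNIV U" using a by (simp add: loc_UNIV)
  then have "Q UNIV" unfolding Q_def by blast
  then have "\<exists>C. Q C \<and> (\<forall>D. Q D \<longrightarrow> card C \<le> card D)" by (rule ex_has_least_nat)
  then obtain C where C: "Q C" "\<And>D. Q D \<Longrightarrow> card C \<le> card D" by blast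
  obtain d where d: "a + d \<notin> loc C U" using C(1) by (auto simp: Q_def)
  let ?a = "a + d"
  have "\<exists>b. b \<notin> meets (C - {v}) \<and> ?a + b \<in> U" if "v \<in> C" for v
  proof (rule ccontr)
    assume "\<not> ?thesis"
    then have "Q (C - {v})" by (auto simp: Q_def loc_def)
    then have "card C \<le> card (C - {v})" by (rule C(2))
    moreover have "card (C - {v}) < card C" using that by (intro psubset_card_mono) auto
    ultimately show False by simp
  qed
  then obtain b where b: "\<And>v. v \<in> C \<Longrightarrow> b v \<notin> meets (C - {v}) \<and> ?a + b v \<in> U" by metis
  define deg where "deg e = (\<Sum>v\<in>C. Poly_Mapping.lookup e v)" for e :: "'v expo"
  define N where "N = Suc (\<Sum>v\<in>C. Poly_Mapping.lookup (b v) v)"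
  \<comment> \<open>A multiple outside the localization cannot contain the power of $v$ that occurs in \<open>b v\<close>.\<close>
  have bound: "Poly_Mapping.lookup e v < Poly_Mapping.lookup (b v) v"
    if e: "?a + e \<notin> loc C U" and v: "v \<in> C" for e v
  proof (rule ccontr)
    assume le: "\<not> ?thesis"
    define c where "c = b v - Poly_Mapping.single v (Poly_Mapping.lookup (b v) v)"
    define e' where "e' = e - Poly_Mapping.single v (Poly_Mapping.lookup (b v) v)"
    have ec: "e + c = b v + e'"
      by (rule poly_mapping_eqI)
        (use le in \<open>auto simp: c_def e'_def lookup_add lookup_minus lookup_single when_def\<close>)
    have "?a + b v + e' \<in> U" using up_closedD(1)[OF U conjunct2[OF b[OF v]]] .
    then have "?a + e + c \<in> U" unfolding add.assoc ec .
    moreover have "c \<notin> meets C"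
    proof -
      have "Poly_Mapping.lookup c u = 0" if "u \<in> C" for u
      proof (cases "u = v")
        case False
        then have "u \<notin> Poly_Mapping.keys (b v)" using b[OF v] that by (auto simp: meets_def)
        then show ?thesis by (simp add: c_def lookup_minus in_keys_iff)
      qed (simp add: c_def lookup_minus)
      then show ?thesis by (auto simp: meets_def in_keys_iff)
    qed
    ultimately show False using e unfolding loc_def by blast
  qed
  have "\<forall>e. ?a + e \<notin> loc C U \<longrightarrow> deg e < N"
    unfolding deg_def N_def by (auto intro!: le_imp_less_Suc sum_mono less_imp_le[OF bound])
  moreover have "?a + 0 \<notin> loc C U" using d by simp
  ultimately have "\<exists>e. ?a + e \<notin> loc C U \<and> (\<forall>e'. ?a + e' \<notin> loc C U \<longrightarrow> deg e' \<le> deg e)"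
    by (intro ex_has_greatest_nat[where P = "\<lambda>e. ?a + e \<notin> loc C U" and f = deg])
  then obtain e where e: "?a + e \<notin> loc C U"
    and max: "\<And>e'. ?a + e' \<notin> loc C U \<Longrightarrow> deg e' \<le> deg e"
    by blast
  have "?a + e + Poly_Mapping.single v 1 \<in> loc C U" if "v \<in> C" for v
  proof (rule ccontr)
    assume "\<not> ?thesis"
    then have "deg (e + Poly_Mapping.single v 1) \<le> deg e" by (intro max) (simp add: add.assoc)
    then show False using that
      by (simp add: deg_def lookup_add lookup_single when_def sum.distrib)
  qed
  then have "C \<in> assoc U"
    by (intro assoc_of_socle[OF U order_refl, where a = "?a + e"]) (simp_all add: e loc_loc)
  moreover have "a \<notin> loc C U"
    using up_closedD(1)[OF up_closed_loc[OF U], of a C "d + e"] e by (auto simp: add.assoc)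
  ultimately show ?thesis by blast
qed

lemma assoc_cover: "C \<in> assoc U \<Longrightarrow> up_closed U \<Longrightarrow> U \<subseteq> meets C"
  unfolding assoc_def using up_closedD(2) by blast

text \<open>Localized at \<open>C\<close>, the set \<open>U\<close> still is proper. Its associated sets are contained in \<open>C\<close> and are
associated to \<open>U\<close> itself.\<close>

lemma cover_contains_assoc:
  fixes U :: "'v::finite expo set"
  assumes U: "up_closed U" and C: "U \<subseteq> meets C"
  shows "\<exists>D\<in>assoc U. D \<subseteq> C"
proof -
  have "0 \<notin> loc C U" using C by (auto simp: loc_def)
  then obtain D where D: "D \<in> assoc (loc C U)" using assoc_separates[OF up_closed_loc[OF U]] by blast
  then obtain a where a: "\<And>b. a + b \<in> loc C U \<longleftrightarrow> b \<in> meets D" by (auto simp: assoc_def)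
  have DC: "D \<subseteq> C"
  proof
    fix v assume "v \<in> D"
    then have "a + Poly_Mapping.single v 1 \<in> loc C U" by (simp add: a)
    moreover have "a \<notin> loc C U" using a[of 0] by simp
    ultimately show "v \<in> C" using loc_cancel[of a "Poly_Mapping.single v 1" C U] by auto
  qed
  have "D \<in> assoc U"
    by (rule assoc_of_socle[OF U DC, where a = a]) (use a in \<open>auto simp: loc_def[of D]\<close>)
  then show ?thesis using DC by blast
qed

lemma sumset_power_antimono:
  assumes "up_closed U" "m \<le> n"
  shows "sumset_power U n \<subseteq> sumset_power U m"
  using assms(2)
proof (induction rule: dec_induct)
  case (step n)
  have "sumset (sumset_power U n) U \<subseteq> sumset_power U n"
    unfolding sumset_def using up_closedD(1)[OF up_closed_sumset_power[OF assms(1), of n]] by blast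
  then show ?case using step by auto
qed simp

lemma loc_mono: "U \<subseteq> V \<Longrightarrow> loc C U \<subseteq> loc C V"
  by (auto simp: loc_def)

lemma loc_sumset_power_add:
  assumes "up_closed U" "a \<in> loc C U" "b \<in> loc C (sumset_power U n)"
  shows "b + a \<in> loc C (sumset_power U (Suc n))"
proof -
  obtain c d where "c \<notin> meets C" "a + c \<in> U" "d \<notin> meets C" "b + d \<in> sumset_power U n"
    using assms by (auto simp: loc_def)
  moreover from this have "(b + d) + (a + c) \<in> sumset_power U (Suc n)" by (auto simp: sumset_def)
  ultimately show ?thesis unfolding loc_def
    by (intro CollectI exI[of _ "d + c"]) (auto simp: meets_add ac_simps)
qed

lemma loc_sumset_power_multiple:
  fixes U :: "'v expo set"
  assumes "up_closed U" "Poly_Mapping.single v k \<in> loc C U" "b \<in> loc C (sumset_power U n)"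
  shows "b + Poly_Mapping.single v (k * m) \<in> loc C (sumset_power U (n + m))"
proof (induction m)
  case (Suc m)
  have "b + Poly_Mapping.single v (k * m) + Poly_Mapping.single v k \<in> loc C (sumset_power U (Suc (n + m)))"
    by (rule loc_sumset_power_add[OF assms(1,2) Suc])
  moreover have "b + Poly_Mapping.single v (k * m) + Poly_Mapping.single v k = b + Poly_Mapping.single v (k * Suc m)"
    by (simp add: single_add ac_simps)
  ultimately show ?case by simp
qed (use assms in simp)

section \<open>Weighted matchings in bipartite graphs\<close>

definition vertex_cover :: "('v \<times> 'v) set \<Rightarrow> 'v set \<Rightarrow> bool" where
  "vertex_cover E C \<longleftrightarrow> (\<forall>(i, j)\<in>E. i \<in> C \<or> j \<in> C)"

text \<open>The inductive step of the weighted theorem of Koenig: an edge whose removal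
leaves every cover with capacity at least $n$. Only tight covers that contain both ends of the edge are
dangerous. Fix a vertex $x$ of positive capacity with a neighbour of positive capacity. The tight
covers that contain $x$ form a lattice under the operations that intersect on the side of $x$ and
unite on the other side. In the one that is largest on the other side, $x$ cannot be dropped, so some
edge at $x$ has its other end, of positive capacity, outside this cover and hence outside every tight
cover that contains $x$.\<close>

lemma koenig_step:
  fixes q :: "'v::finite \<Rightarrow> nat" and F :: "('v \<times> 'v) set"
  assumes bip: "\<And>x y. (x, y) \<in> F \<Longrightarrow> x \<in> A \<and> y \<notin> A"
    and cov: "\<And>C. vertex_cover F C \<Longrightarrow> Suc n \<le> sum q C"
  shows "\<exists>x y. (x, y) \<in> F \<and> q x \<noteq> 0 \<and> q y \<noteq> 0 \<and>
    (\<forall>C. vertex_cover F C \<longrightarrow> x \<in> C \<longrightarrow> y \<in> C \<longrightarrow> Suc n < sum q C)"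
proof -
  let ?Z = "{v. q v = 0}"
  define tight where "tight C \<longleftrightarrow> vertex_cover F C \<and> sum q C = Suc n" for C
  have tightI: "Suc n < sum q C" if "vertex_cover F C" "\<not> tight C" for C
    using cov[of C] that by (auto simp: tight_def)
  have "\<not> vertex_cover F ?Z" using cov[of ?Z] by auto
  then obtain x y0 where xy0: "(x, y0) \<in> F" "q x \<noteq> 0" "q y0 \<noteq> 0"
    by (auto simp: vertex_cover_def)
  have xA: "x \<in> A" using bip xy0 by blast
  show ?thesis
  proof (cases "\<exists>M. tight M \<and> x \<in> M")
    case False
    then show ?thesis using xy0 tightI by blast
  next
    case True
    then obtain M0 where "tight M0 \<and> x \<in> M0" by blast
    moreover have "\<forall>M. tight M \<and> x \<in> M \<longrightarrow> card (M - A) < Suc (card (UNIV :: 'v set))"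
      by (auto intro!: le_imp_less_Suc card_mono)
    ultimately have "\<exists>M. (tight M \<and> x \<in> M) \<and> (\<forall>C. tight C \<and> x \<in> C \<longrightarrow> card (C - A) \<le> card (M - A))"
      by (rule ex_has_greatest_nat)
    then obtain M where M: "tight M" "x \<in> M"
      and max: "\<And>C. tight C \<Longrightarrow> x \<in> C \<Longrightarrow> card (C - A) \<le> card (M - A)"
      by blast
    \<comment> \<open>Replacing $x$ by all vertices of capacity zero lowers the total, so this is no cover.\<close>
    have "sum q ((M - {x}) \<union> ?Z) \<le> sum q (M - {x}) + sum q ?Z"
      by (subst sum.union_inter[symmetric]) auto
    also have "\<dots> = sum q (M - {x})" by simp
    also have "\<dots> < sum q M" using M(2) xy0(2) by (subst sum.remove[of M x]) auto
    finally have "\<not> vertex_cover F ((M - {x}) \<union> ?Z)" using cov M(1) by (fastforce simp: tight_def)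
    then obtain x' y where xy: "(x', y) \<in> F" "x' \<notin> M - {x}" "y \<notin> M - {x}" "q x' \<noteq> 0" "q y \<noteq> 0"
      by (auto simp: vertex_cover_def)
    have "x' \<in> M \<or> y \<in> M" using M(1) xy(1) by (auto simp: tight_def vertex_cover_def)
    moreover have "y \<noteq> x" using bip xy(1) xA by blast
    ultimately have x': "x' = x" and y: "y \<notin> M" using xy by auto
    have yA: "y \<notin> A" using bip xy by blast
    have "\<not> tight C" if C: "x \<in> C" "y \<in> C" for C
    proof
      assume t: "tight C"
      \<comment> \<open>Meet and join of two tight covers. Their totals add up to those of \<open>C\<close> and \<open>M\<close>, so both are tight.\<close>
      define C1 where "C1 = (C \<inter> M \<inter> A) \<union> ((C \<union> M) - A)"
      define C2 where "C2 = ((C \<union> M) \<inter> A) \<union> ((C \<inter> M) - A)"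
      have cov12: "vertex_cover F C1" "vertex_cover F C2"
        using t M(1) bip unfolding vertex_cover_def tight_def C1_def C2_def by blast+
      have "sum q C1 + sum q C2 = sum q (C1 \<union> C2) + sum q (C1 \<inter> C2)"
        by (rule sum.union_inter[symmetric]) auto
      also have "C1 \<union> C2 = C \<union> M" by (auto simp: C1_def C2_def)
      also have "C1 \<inter> C2 = C \<inter> M" by (auto simp: C1_def C2_def)
      also have "sum q (C \<union> M) + sum q (C \<inter> M) = sum q C + sum q M"
        by (rule sum.union_inter) auto
      finally have "tight C1" using cov[OF cov12(1)] cov[OF cov12(2)] t M(1) cov12 by (simp add: tight_def)
      moreover have "x \<in> C1" using C(1) M(2) xA by (simp add: C1_def)
      ultimately have "card (C1 - A) \<le> card (M - A)" by (rule max)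
      moreover have "card (M - A) < card (C1 - A)"
        using C(2) y yA by (intro psubset_card_mono) (auto simp: C1_def)
      ultimately show False by simp
    qed
    then show ?thesis using xy x' xy0 tightI by blast
  qed
qed

section \<open>Powers of edge ideals\<close>

definition edge_exponents :: "('v \<times> 'v) set \<Rightarrow> ('v \<Rightarrow> nat) \<Rightarrow> 'v expo set" where
  "edge_exponents E w = sumset {Poly_Mapping.single i 1 + Poly_Mapping.single j (w j) |i j. (i, j) \<in> E} UNIV"

lemma up_closed_edge_exponents: "up_closed (edge_exponents E w)"
  unfolding edge_exponents_def by (rule up_closed_sumset) (simp add: up_closed_def)

lemma edge_exponentsI:
  "(i, j) \<in> E \<Longrightarrow> Poly_Mapping.single i 1 + Poly_Mapping.single j (w j) + b \<in> edge_exponents E w"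
  unfolding edge_exponents_def sumset_def by blast

lemma edge_exponentsE:
  assumes "a \<in> edge_exponents E w"
  obtains i j b where "(i, j) \<in> E" "a = Poly_Mapping.single i 1 + Poly_Mapping.single j (w j) + b"
  using assms unfolding edge_exponents_def sumset_def by blast

lemma edge_ideal_eq:
  "(edge_ideal E w :: ('v, 'k::field) mpoly set) = mono_ideal (edge_exponents E w)"
proof -
  have pow: "(indet j :: ('v, 'k) mpoly) ^ k = mon (Poly_Mapping.single j k)" for j :: 'v and k
    by (induction k) (simp_all add: indet_def mult_single single_add[symmetric])
  have "{indet i * indet j ^ w j :: ('v, 'k) mpoly |i j. (i, j) \<in> E} =
    mon ` {Poly_Mapping.single i 1 + Poly_Mapping.single j (w j) |i j. (i, j) \<in> E}"
    unfolding pow by (auto simp: indet_def mult_single)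
  then show ?thesis unfolding edge_ideal_def edge_exponents_def genideal_monomials[symmetric] by simp
qed

lemma edge_exponents_subset_meets_iff:
  assumes "\<And>v. 1 \<le> w v"
  shows "edge_exponents E w \<subseteq> meets C \<longleftrightarrow> vertex_cover E C"
proof
  assume sub: "edge_exponents E w \<subseteq> meets C"
  show "vertex_cover E C" unfolding vertex_cover_def
  proof safe
    fix i j assume "(i, j) \<in> E" "j \<notin> C"
    with subsetD[OF sub edge_exponentsI[OF this(1), of w 0]] show "i \<in> C"
      by (simp only: meets_add single_meets_iff zero_not_meets) simp
  qed
next
  assume C: "vertex_cover E C"
  show "edge_exponents E w \<subseteq> meets C"
  proof
    fix a assume "a \<in> edge_exponents E w"
    then obtain i j b where "(i, j) \<in> E" and a: "a = Poly_Mapping.single i 1 + Poly_Mapping.single j (w j) + b"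
      by (rule edge_exponentsE)
    then have "i \<in> C \<or> j \<in> C" using C by (auto simp: vertex_cover_def)
    moreover have "w j \<noteq> 0" using assms[of j] by simp
    ultimately show "a \<in> meets C" unfolding a meets_add single_meets_iff by simp
  qed
qed

text \<open>Each generator uses up $w_v$ at both of its ends, so it takes one unit of the capacity
$\lfloor a_v / w_v \rfloor$ there. The hypothesis on tails holds once heavy vertices are sinks.
With $r = 1$ this bounds the capacity of a vertex cover, with $r = 2$ and \<open>C\<close> everything it is a degree bound.\<close>

lemma sumset_power_div_sum:
  fixes w :: "'v::finite \<Rightarrow> nat"
  assumes w: "\<And>v. 1 \<le> w v" and w1: "\<And>i j. (i, j) \<in> E \<Longrightarrow> w i = 1 \<and> i \<noteq> j"
    and r: "\<And>i j. (i, j) \<in> E \<Longrightarrow> r \<le> card ({i, j} \<inter> C)"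
    and a: "a \<in> sumset_power (edge_exponents E w) n"
  shows "r * n \<le> (\<Sum>v\<in>C. Poly_Mapping.lookup a v div w v)"
  using a
proof (induction n arbitrary: a)
  case (Suc n)
  then obtain b u where b: "b \<in> sumset_power (edge_exponents E w) n"
    and u: "u \<in> edge_exponents E w" "a = b + u" by (auto simp: sumset_def)
  from u(1) obtain i j c where ij: "(i, j) \<in> E"
    and uc: "u = Poly_Mapping.single i 1 + Poly_Mapping.single j (w j) + c" by (rule edge_exponentsE)
  have ge: "Poly_Mapping.lookup b v div w v + (if v \<in> {i, j} then 1 else 0) \<le> Poly_Mapping.lookup a v div w v" for v
  proof -
    have "Poly_Mapping.lookup b v + (if v \<in> {i, j} then w v else 0) \<le> Poly_Mapping.lookup a v"
      using w1[OF ij] by (auto simp: u(2) uc lookup_add lookup_single when_def)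
    then have "(Poly_Mapping.lookup b v + (if v \<in> {i, j} then w v else 0)) div w v \<le> Poly_Mapping.lookup a v div w v"
      by (rule div_le_mono)
    then show ?thesis using w[of v] by (auto split: if_splits)
  qed
  have "r * Suc n \<le> (\<Sum>v\<in>C. Poly_Mapping.lookup b v div w v) + card ({i, j} \<inter> C)"
    using Suc.IH[OF b] r[OF ij] by simp
  also have "card ({i, j} \<inter> C) = (\<Sum>v\<in>C. if v \<in> {i, j} then 1 else 0)"
    by (simp add: sum.If_cases Int_commute del: insert_iff)
  also have "(\<Sum>v\<in>C. Poly_Mapping.lookup b v div w v) + (\<Sum>v\<in>C. if v \<in> {i, j} then 1 else 0) \<le>
    (\<Sum>v\<in>C. Poly_Mapping.lookup a v div w v)"
    unfolding sum.distrib[symmetric] by (intro sum_mono ge)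
  finally show ?case .
qed simp

text \<open>The edge found by \<open>koenig_step\<close> for the capacities $\lfloor a_v / w_v \rfloor$ splits off a
generator, since removing $w_v$ lowers the capacity at $v$ by exactly one.\<close>

lemma sumset_power_if_covers:
  fixes w :: "'v::finite \<Rightarrow> nat"
  assumes w: "\<And>v. 1 \<le> w v" and w1: "\<And>i j. (i, j) \<in> E \<Longrightarrow> w i = 1 \<and> i \<noteq> j"
    and bip: "\<And>i j. (i, j) \<in> E \<Longrightarrow> (i \<in> A) \<noteq> (j \<in> A)"
    and a: "\<And>C. vertex_cover E C \<Longrightarrow> n \<le> (\<Sum>v\<in>C. Poly_Mapping.lookup a v div w v)"
  shows "a \<in> sumset_power (edge_exponents E w) n"
  using a
proof (induction n arbitrary: a)
  case (Suc n)
  define F where "F = {(x, y). ((x, y) \<in> E \<or> (y, x) \<in> E) \<and> x \<in> A \<and> y \<notin> A}"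
  have cov: "vertex_cover F C \<longleftrightarrow> vertex_cover E C" for C
    using bip by (fastforce simp: vertex_cover_def F_def)
  define q where "q v = Poly_Mapping.lookup a v div w v" for v
  have "\<exists>x y. (x, y) \<in> F \<and> q x \<noteq> 0 \<and> q y \<noteq> 0 \<and>
    (\<forall>C. vertex_cover F C \<longrightarrow> x \<in> C \<longrightarrow> y \<in> C \<longrightarrow> Suc n < sum q C)"
  proof (rule koenig_step)
    show "x \<in> A \<and> y \<notin> A" if "(x, y) \<in> F" for x y using that by (simp add: F_def)
    show "Suc n \<le> sum q C" if "vertex_cover F C" for C
      using Suc.prems[of C] that by (simp add: cov q_def)
  qed
  then obtain x y where xy: "(x, y) \<in> F" "q x \<noteq> 0" "q y \<noteq> 0"
    and slack: "\<And>C. vertex_cover E C \<Longrightarrow> x \<in> C \<Longrightarrow> y \<in> C \<Longrightarrow> Suc n < sum q C"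
    unfolding cov by blast
  have ne: "x \<noteq> y" using xy(1) by (auto simp: F_def)
  define e where "e = Poly_Mapping.single x (w x) + Poly_Mapping.single y (w y)"
  have e: "e \<in> edge_exponents E w"
  proof (cases "(x, y) \<in> E")
    case True
    then show ?thesis using edge_exponentsI[OF True, of w 0] w1[OF True] by (simp add: e_def)
  next
    case False
    then have "(y, x) \<in> E" using xy(1) by (simp add: F_def)
    then show ?thesis using edge_exponentsI[of y x E w 0] w1[of y x] by (simp add: e_def add.commute)
  qed
  define b where "b = a - e"
  have le: "w v \<le> Poly_Mapping.lookup a v" if "q v \<noteq> 0" for v
    using that by (metis div_less not_le q_def)
  have ab: "a = b + e" unfolding b_def e_def
    by (rule poly_mapping_eqI)
      (use le xy ne in \<open>auto simp: lookup_add lookup_minus lookup_single when_def\<close>)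
  have qb: "q v = Poly_Mapping.lookup b v div w v + (if v \<in> {x, y} then 1 else 0)" for v
    using w[of v] ne by (auto simp: q_def ab e_def lookup_add lookup_single when_def)
  have "n \<le> (\<Sum>v\<in>C. Poly_Mapping.lookup b v div w v)" if C: "vertex_cover E C" for C
  proof -
    have "sum q C = (\<Sum>v\<in>C. Poly_Mapping.lookup b v div w v) + (\<Sum>v\<in>C. if v \<in> {x, y} then 1 else 0)"
      by (simp add: qb sum.distrib)
    also have "(\<Sum>v\<in>C. if v \<in> {x, y} then 1 else 0) = card ({x, y} \<inter> C)"
      by (simp add: sum.If_cases Int_commute del: insert_iff)
    finally have eq: "sum q C = (\<Sum>v\<in>C. Poly_Mapping.lookup b v div w v) + card ({x, y} \<inter> C)" .
    have ge: "Suc n \<le> sum q C" using Suc.prems[OF C] by (simp add: q_def)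
    show ?thesis
    proof (cases "x \<in> C \<and> y \<in> C")
      case True
      then have "card ({x, y} \<inter> C) = 2" using ne by (simp add: Int_absorb2)
      then show ?thesis using slack[OF C] True eq by simp
    next
      case False
      then have "{x, y} \<inter> C \<subseteq> {x} \<or> {x, y} \<inter> C \<subseteq> {y}" by blast
      then have "card ({x, y} \<inter> C) \<le> 1"
        using card_mono[of "{x}" "{x, y} \<inter> C"] card_mono[of "{y}" "{x, y} \<inter> C"] by auto
      then show ?thesis using ge eq by simp
    qed
  qed
  then have "b \<in> sumset_power (edge_exponents E w) n" by (rule Suc.IH)
  then show ?case using e ab by (auto simp: sumset_def)
qed simp

section \<open>Edge ideals without embedded primes\<close>

lemma Inter_loc_assoc:
  fixes U :: "'v::finite expo set"
  assumes U: "up_closed U"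
  shows "(\<Inter>C\<in>assoc U. loc C U) = U"
  using assoc_separates[OF U] subset_loc[of U] by blast

text \<open>The equality of cardinalities makes the map from directed to undirected edges injective; this
excludes a pair of opposite directed edges.\<close>

lemma weighted_oriented_graphD:
  assumes "weighted_oriented_graph G E w"
  shows "1 \<le> w v" "(i, j) \<in> E \<Longrightarrow> i \<noteq> j" "(i, j) \<in> E \<Longrightarrow> (j, i) \<notin> E"
    "{i, j} \<in> G \<longleftrightarrow> (i, j) \<in> E \<or> (j, i) \<in> E"
    "e \<in> G \<Longrightarrow> \<exists>i j. (i, j) \<in> E \<and> e = {i, j}"
proof -
  have G: "simple_graph G" "G = {{a, b} |a b. (a, b) \<in> E}" "card E = card G"
    using assms by (auto simp: weighted_oriented_graph_def)
  show "1 \<le> w v" using assms by (simp add: weighted_oriented_graph_def)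
  have ne: "i \<noteq> j" if "(i, j) \<in> E" for i j
  proof -
    have "{i, j} \<in> G" using that G(2) by blast
    then have "card {i, j} = 2" using G(1) by (simp add: simple_graph_def)
    then show ?thesis by auto
  qed
  show "(i, j) \<in> E \<Longrightarrow> i \<noteq> j" by (rule ne)
  have img: "G = (\<lambda>(a, b). {a, b}) ` E" using G(2) by auto
  then have "inj_on (\<lambda>(a, b). {a, b}) E" using G(3) by (intro eq_card_imp_inj_on) auto
  then show "(j, i) \<notin> E" if "(i, j) \<in> E"
    using inj_onD[of "\<lambda>(a, b). {a, b}" E "(i, j)" "(j, i)"] that ne[OF that] by (auto simp: insert_commute)
  show "{i, j} \<in> G \<longleftrightarrow> (i, j) \<in> E \<or> (j, i) \<in> E"
    unfolding G(2) by (auto simp: doubleton_eq_iff)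
  show "e \<in> G \<Longrightarrow> \<exists>i j. (i, j) \<in> E \<and> e = {i, j}" unfolding G(2) by auto
qed

text \<open>The function $\mu$ counts the visits of the walk to each vertex, its end excluded. Every step of the
walk meets a cover, and each visit serves two steps, up to the boundary terms. For a closed walk the
boundary terms cancel.\<close>

lemma relpow_tally:
  fixes E :: "('v::finite \<times> 'v) set"
  assumes "(x, y) \<in> (E \<union> E\<inverse>) ^^ n"
  shows "\<exists>\<mu> :: 'v \<Rightarrow> nat. sum \<mu> UNIV = n \<and>
    (\<forall>C. vertex_cover E C \<longrightarrow> n + of_bool (x \<in> C) \<le> 2 * sum \<mu> C + of_bool (y \<in> C))"
  using assms
proof (induction n arbitrary: y)
  case 0
  then show ?case by (intro exI[of _ "\<lambda>_. 0"]) simp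
next
  case (Suc n)
  then obtain z where z: "(x, z) \<in> (E \<union> E\<inverse>) ^^ n" "(z, y) \<in> E \<union> E\<inverse>" by auto
  from Suc.IH[OF z(1)] obtain \<mu> :: "'v \<Rightarrow> nat" where \<mu>: "sum \<mu> UNIV = n"
    "\<And>C. vertex_cover E C \<Longrightarrow> n + of_bool (x \<in> C) \<le> 2 * sum \<mu> C + of_bool (z \<in> C)" by blast
  define \<nu> where "\<nu> v = \<mu> v + of_bool (v = z)" for v
  have \<nu>: "sum \<nu> C = sum \<mu> C + of_bool (z \<in> C)" for C
    by (simp add: \<nu>_def sum.distrib of_bool_def)
  have "Suc n + of_bool (x \<in> C) \<le> 2 * sum \<nu> C + of_bool (y \<in> C)" if C: "vertex_cover E C" for C
  proof -
    have "z \<in> C \<or> y \<in> C" using z(2) C by (auto simp: vertex_cover_def)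
    then show ?thesis using \<mu>(2)[OF C] by (auto simp: \<nu>)
  qed
  then show ?case using \<mu>(1) \<nu>[of UNIV] by (intro exI[of _ \<nu>]) simp
qed

text \<open>In the absence of odd closed walks, the vertices at an even distance from a chosen root in
each component form one side of a bipartition.\<close>

lemma odd_closed_walk_if_not_bipartite:
  assumes G: "weighted_oriented_graph G E w" and nb: "\<not> bipartite G"
  shows "\<exists>x n. odd n \<and> (x, x) \<in> (E \<union> E\<inverse>) ^^ n"
proof (rule ccontr)
  assume no: "\<not> ?thesis"
  let ?R = "E \<union> E\<inverse>"
  have sym: "(y, x) \<in> ?R ^^ n" if "(x, y) \<in> ?R ^^ n" for x y n
    using that
  proof (induction n arbitrary: y)
    case (Suc n)
    then obtain z where "(x, z) \<in> ?R ^^ n" "(z, y) \<in> ?R" by auto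
    then show ?case using Suc.IH by (intro relpow_Suc_I2[of y z]) auto
  qed simp
  define root where "root v = (SOME u. (v, u) \<in> ?R\<^sup>*)" for v
  have root: "(v, root v) \<in> ?R\<^sup>*" for v unfolding root_def by (rule someI[of _ v]) simp
  have root_eq: "root a = root b" if "(a, b) \<in> ?R" for a b
  proof -
    have "(b, a) \<in> ?R" using that by auto
    then have "(a, u) \<in> ?R\<^sup>* \<longleftrightarrow> (b, u) \<in> ?R\<^sup>*" for u
      using that by (meson converse_rtrancl_into_rtrancl)
    then show ?thesis by (simp add: root_def)
  qed
  define A where "A = {v. \<exists>n. even n \<and> (root v, v) \<in> ?R ^^ n}"
  have parity: "(a \<in> A) \<noteq> (b \<in> A)" if ab: "(a, b) \<in> ?R" for a b
  proof -
    obtain i where "(a, root a) \<in> ?R ^^ i" using root[of a] rtrancl_power by blast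
    then have i: "(root a, a) \<in> ?R ^^ i" by (rule sym)
    then have i1: "(root b, b) \<in> ?R ^^ Suc i" using ab root_eq[OF ab] by auto
    have no_both: False if both: "a \<in> A" "b \<in> A"
    proof -
      obtain m n where mn: "even m" "even n" "(root a, a) \<in> ?R ^^ m" "(root a, b) \<in> ?R ^^ n"
        using both root_eq[OF ab] by (auto simp: A_def)
      have "(root a, b) \<in> ?R ^^ Suc m" using mn(3) ab by auto
      moreover have "(b, root a) \<in> ?R ^^ n" by (rule sym[OF mn(4)])
      ultimately have "(root a, root a) \<in> ?R ^^ (Suc m + n)" unfolding relpow_add by blast
      moreover have "odd (Suc m + n)" using mn by simp
      ultimately show False using no by blast
    qed
    have "a \<in> A \<or> b \<in> A"
    proof (cases "even i")
      case True
      then show ?thesis using i by (auto simp: A_def)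
    next
      case False
      then have "even (Suc i)" by simp
      then show ?thesis using i1 unfolding A_def by blast
    qed
    then show ?thesis using no_both by blast
  qed
  have "bipartite G" unfolding bipartite_def
  proof (intro exI[of _ A] ballI)
    fix e assume "e \<in> G"
    then obtain i j where ij: "(i, j) \<in> E" "e = {i, j}" using weighted_oriented_graphD(5)[OF G] by blast
    then have "(i \<in> A) \<noteq> (j \<in> A)" using parity[of i j] by simp
    then show "\<exists>a\<in>A. \<exists>b\<in>- A. e = {a, b}" using ij(2) by (metis ComplI insert_commute)
  qed
  then show False using nb by simp
qed

text \<open>The absence of embedded primes in combinatorial form.\<close>

locale unmixed_graph =
  fixes G :: "'v::finite set set" and E :: "('v \<times> 'v) set" and w :: "'v \<Rightarrow> nat"
  assumes graph: "weighted_oriented_graph G E w"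
    and unmixed: "\<And>C D. C \<in> assoc (edge_exponents E w) \<Longrightarrow> D \<in> assoc (edge_exponents E w) \<Longrightarrow> \<not> D \<subset> C"
begin

abbreviation "U \<equiv> edge_exponents E w"

lemmas graphD = weighted_oriented_graphD[OF graph]
lemmas U_up = up_closed_edge_exponents[of E w]
lemmas U_meets_iff = edge_exponents_subset_meets_iff[OF graphD(1), of E]

lemma assoc_vertex_cover: "C \<in> assoc U \<Longrightarrow> vertex_cover E C"
  using assoc_cover[OF _ U_up, of C] unfolding U_meets_iff .

lemma assoc_subset_cover: "vertex_cover E C \<Longrightarrow> \<exists>D\<in>assoc U. D \<subseteq> C"
  using cover_contains_assoc[OF U_up, of C] unfolding U_meets_iff .

lemma tail_in_loc: "(v, u) \<in> E \<Longrightarrow> u \<notin> C \<Longrightarrow> Poly_Mapping.single v 1 \<in> loc C U"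
  unfolding loc_def mem_Collect_eq
  by (rule exI[of _ "Poly_Mapping.single u (w u)"]) (use edge_exponentsI[of v u E w 0] in simp)

text \<open>The vertex has a neighbour outside \<open>C\<close>: otherwise removing it would leave a vertex cover, and this would
contain a smaller associated set.\<close>

lemma weight_power_in_loc:
  assumes C: "C \<in> assoc U" and v: "v \<in> C"
  shows "Poly_Mapping.single v (w v) \<in> loc C U"
proof -
  have "\<exists>u. u \<notin> C \<and> ((u, v) \<in> E \<or> (v, u) \<in> E)"
  proof (rule ccontr)
    assume none: "\<not> ?thesis"
    have "i \<in> C - {v} \<or> j \<in> C - {v}" if ij: "(i, j) \<in> E" for i j
      using ij none graphD(2)[OF ij] assoc_vertex_cover[OF C] by (auto simp: vertex_cover_def)
    then have "vertex_cover E (C - {v})" unfolding vertex_cover_def by blast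
    then obtain D where "D \<in> assoc U" "D \<subseteq> C - {v}" using assoc_subset_cover by blast
    then show False using unmixed[OF C, of D] v by blast
  qed
  then obtain u where u: "u \<notin> C" and "(u, v) \<in> E \<or> (v, u) \<in> E" by blast
  from this(2) show ?thesis
  proof
    assume "(u, v) \<in> E"
    then have "Poly_Mapping.single v (w v) + Poly_Mapping.single u 1 \<in> U"
      using edge_exponentsI[of u v E w 0] by (simp add: add.commute)
    then show ?thesis using u unfolding loc_def
      by (intro CollectI exI[of _ "Poly_Mapping.single u 1"]) simp
  next
    assume "(v, u) \<in> E"
    then have "Poly_Mapping.single v 1 + Poly_Mapping.single v (w v - 1) \<in> loc C U"
      by (intro up_closedD(1)[OF up_closed_loc[OF U_up]] tail_in_loc[OF _ u])
    then show ?thesis using graphD(1)[of v] by (simp add: single_add[symmetric])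
  qed
qed

lemma loc_power2I: "a \<in> loc C U \<Longrightarrow> b \<in> loc C U \<Longrightarrow> a + b \<in> loc C (sumset_power U 2)"
proof -
  assume a: "a \<in> loc C U" and b: "b \<in> loc C U"
  have "0 \<in> loc C (sumset_power U 0)" using subset_loc[of "UNIV :: 'v expo set" C] by auto
  then have "0 + a \<in> loc C (sumset_power U (Suc 0))" by (rule loc_sumset_power_add[OF U_up a])
  then have "0 + a + b \<in> loc C (sumset_power U (Suc (Suc 0)))" by (rule loc_sumset_power_add[OF U_up b])
  then show ?thesis by (simp add: numeral_2_eq_2)
qed

text \<open>The witness is $t_z t_x^{w_x} t_y^{w_y}$ for edges $z \to x \to y$. It lies in the second symbolic
power, since two of its factors lie in each localized ideal. If the cover misses $x$, then $t_x$ is a unit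
and $y$ is in the cover, so $t_z$ and $t_y^{w_y}$ are such factors. If $x$ is in the cover and $y$ is not,
$t_x$ serves twice, because $w_x > 1$. If both are, $t_x^{w_x}$ and $t_y^{w_y}$ do. The monomial is not in
the second power: the product of any two generators on the three vertices exceeds one of its exponents.\<close>

lemma heavy_vertex_is_sink:
  assumes sources: "\<forall>v. source E v \<longrightarrow> w v = 1"
    and symb: "sumset_power U 2 = (\<Inter>C\<in>assoc U. loc C (sumset_power U 2))"
    and x: "x \<in> V_plus w"
  shows "sink E x"
proof (rule ccontr)
  assume "\<not> sink E x"
  then obtain y where xy: "(x, y) \<in> E" by (auto simp: sink_def)
  have wx: "1 < w x" using x by (simp add: V_plus_def)
  then have "\<not> source E x" using sources by auto
  then obtain z where zx: "(z, x) \<in> E" by (auto simp: source_def)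
  have ne: "x \<noteq> y" "z \<noteq> x" "z \<noteq> y" using graphD(2)[OF xy] graphD(2)[OF zx] graphD(3)[OF xy] zx by auto
  define m where "m = Poly_Mapping.single z 1 + Poly_Mapping.single x (w x) + Poly_Mapping.single y (w y)"
  have up2: "up_closed (loc C (sumset_power U 2))" for C
    by (intro up_closed_loc up_closed_sumset_power U_up)
  have "m \<in> loc C (sumset_power U 2)" if C: "C \<in> assoc U" for C
  proof -
    have cov: "vertex_cover E C" by (rule assoc_vertex_cover[OF C])
    consider "x \<notin> C" | "x \<in> C" "y \<notin> C" | "x \<in> C" "y \<in> C" by blast
    then show ?thesis
    proof cases
      case 1
      then have "y \<in> C" using cov xy by (auto simp: vertex_cover_def)
      then have "Poly_Mapping.single z 1 + Poly_Mapping.single y (w y) \<in> loc C (sumset_power U 2)"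
        by (intro loc_power2I tail_in_loc[OF zx 1] weight_power_in_loc[OF C])
      from up_closedD(1)[OF up2 this, of "Poly_Mapping.single x (w x)"] show ?thesis
        by (simp add: m_def ac_simps)
    next
      case 2
      have "Poly_Mapping.single x 1 + Poly_Mapping.single x 1 \<in> loc C (sumset_power U 2)"
        by (intro loc_power2I tail_in_loc[OF xy 2(2)])
      from up_closedD(1)[OF up2 this, of "Poly_Mapping.single x (w x - 2)"]
      have "Poly_Mapping.single x (w x) \<in> loc C (sumset_power U 2)"
        using wx by (simp add: single_add[symmetric] Suc_diff_Suc numeral_2_eq_2)
      from up_closedD(1)[OF up2 this, of "Poly_Mapping.single z 1 + Poly_Mapping.single y (w y)"] show ?thesis
        by (simp add: m_def ac_simps)
    next
      case 3
      have "Poly_Mapping.single x (w x) + Poly_Mapping.single y (w y) \<in> loc C (sumset_power U 2)"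
        by (intro loc_power2I weight_power_in_loc[OF C] 3)
      from up_closedD(1)[OF up2 this, of "Poly_Mapping.single z 1"] show ?thesis
        by (simp add: m_def ac_simps)
    qed
  qed
  then have "m \<in> sumset_power U 2" using symb by blast
  then obtain u1 u2 c where u: "u1 \<in> U" "u2 \<in> U" "m = c + u1 + u2"
    by (auto simp: numeral_2_eq_2 sumset_def)
  obtain i j b where ij: "(i, j) \<in> E" "u1 = Poly_Mapping.single i 1 + Poly_Mapping.single j (w j) + b"
    using u(1) by (rule edge_exponentsE)
  obtain k l d where kl: "(k, l) \<in> E" "u2 = Poly_Mapping.single k 1 + Poly_Mapping.single l (w l) + d"
    using u(2) by (rule edge_exponentsE)
  define r where "r i j v = of_bool (i = v) + of_bool (j = v) * w j" for i j v
  have single: "Poly_Mapping.lookup (Poly_Mapping.single i k) v = of_bool (i = v) * k" for i v :: 'v and k :: nat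
    by (simp add: lookup_single when_def)
  have lookup_u: "Poly_Mapping.lookup u1 v = r i j v + Poly_Mapping.lookup b v"
    "Poly_Mapping.lookup u2 v = r k l v + Poly_Mapping.lookup d v" for v
    by (simp_all only: ij(2) kl(2) r_def lookup_add single mult_1_right)
  have lookup_m: "Poly_Mapping.lookup m v = of_bool (z = v) + of_bool (x = v) * w x + of_bool (y = v) * w y" for v
    by (simp only: m_def lookup_add single mult_1_right)
  have le: "r i j v + r k l v \<le> of_bool (z = v) + of_bool (x = v) * w x + of_bool (y = v) * w y" for v
    using lookup_u[of v] lookup_m[of v] arg_cong[OF u(3), of "\<lambda>a. Poly_Mapping.lookup a v"]
    unfolding lookup_add by linarith
  have shape: "(i', j') = (x, y) \<or> (i', j') = (z, x) \<or> (i', j') = (y, z) \<or> (i', j') = (z, y)"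
    if e: "(i', j') \<in> E" and le': "\<And>v. r i' j' v \<le> of_bool (z = v) + of_bool (x = v) * w x + of_bool (y = v) * w y"
    for i' j'
  proof -
    have "i' \<in> {x, y, z}" by (rule ccontr) (use le'[of i'] in \<open>auto simp: r_def\<close>)
    moreover have "j' \<in> {x, y, z}"
      by (rule ccontr) (use le'[of j'] graphD(1)[of j'] in \<open>auto simp: r_def\<close>)
    ultimately show ?thesis using graphD(2)[OF e] graphD(3)[OF xy] graphD(3)[OF zx] e by auto
  qed
  have s1: "(i, j) = (x, y) \<or> (i, j) = (z, x) \<or> (i, j) = (y, z) \<or> (i, j) = (z, y)"
    by (rule shape[OF ij(1)]) (rule add_leD1[OF le])
  have s2: "(k, l) = (x, y) \<or> (k, l) = (z, x) \<or> (k, l) = (y, z) \<or> (k, l) = (z, y)"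
    by (rule shape[OF kl(1)]) (rule add_leD2[OF le])
  have w0: "w v \<noteq> 0" for v using graphD(1)[of v] by simp
  have at: "r i j x + r k l x \<le> w x" "r i j y + r k l y \<le> w y" "r i j z + r k l z \<le> 1"
    using le[of x] le[of y] le[of z] ne by simp_all
  show False
    using s1
  proof (elim disjE)
    assume "(i, j) = (x, y)"
    with s2 show False using at ne w0[of y] by (elim disjE) (auto simp: r_def)
  next
    assume "(i, j) = (z, x)"
    with s2 show False using at ne w0[of z] by (elim disjE) (auto simp: r_def)
  next
    assume "(i, j) = (y, z)"
    with s2 show False using at ne w0[of z] w0[of y] by (elim disjE) (auto simp: r_def)
  next
    assume "(i, j) = (z, y)"
    with s2 show False using at ne w0[of z] w0[of y] by (elim disjE) (auto simp: r_def)
  qed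
qed

lemma tail_weight:
  assumes "\<forall>v\<in>V_plus w. sink E v" "(i, j) \<in> E"
  shows "w i = 1 \<and> i \<noteq> j"
proof -
  have "i \<notin> V_plus w" using assms by (auto simp: sink_def)
  then show ?thesis using graphD(1)[of i] graphD(2)[OF assms(2)] by (auto simp: V_plus_def)
qed

text \<open>The product of the $t_v^{w_v}$ over an odd closed walk is in a symbolic power, by the count of
visits to covers, but its weighted degree is one too small for the ordinary power.\<close>

lemma underlying_graph_bipartite:
  assumes sinks: "\<forall>v\<in>V_plus w. sink E v"
    and symb: "\<And>n. 1 \<le> n \<Longrightarrow> sumset_power U n = (\<Inter>C\<in>assoc U. loc C (sumset_power U n))"
  shows "bipartite G"
proof (rule ccontr)
  assume "\<not> bipartite G"
  then obtain x n where "odd n" and walk: "(x, x) \<in> (E \<union> E\<inverse>) ^^ n"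
    using odd_closed_walk_if_not_bipartite[OF graph] by blast
  then obtain k where n: "n = 2 * k + 1" by (auto elim: oddE)
  obtain \<mu> :: "'v \<Rightarrow> nat" where \<mu>: "sum \<mu> UNIV = n"
    "\<And>C. vertex_cover E C \<Longrightarrow> n \<le> 2 * sum \<mu> C"
    using relpow_tally[OF walk] by (metis add_le_cancel_right)
  define m where "m C = (\<Sum>v\<in>C. Poly_Mapping.single v (w v * \<mu> v))" for C
  have "m UNIV \<in> loc C (sumset_power U (Suc k))" if C: "C \<in> assoc U" for C
  proof -
    have "m D \<in> loc C (sumset_power U (sum \<mu> D))" if "D \<subseteq> C" for D
      using finite[of D] that
    proof induction
      case empty
      then show ?case using subset_loc[of "UNIV :: 'v expo set" C] by (auto simp: m_def)
    next
      case (insert v D)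
      then have "m D + Poly_Mapping.single v (w v * \<mu> v) \<in> loc C (sumset_power U (sum \<mu> D + \<mu> v))"
        by (intro loc_sumset_power_multiple U_up weight_power_in_loc[OF C]) auto
      then show ?case using insert by (simp add: m_def add.commute)
    qed
    then have "m C \<in> loc C (sumset_power U (sum \<mu> C))" by simp
    moreover have "Suc k \<le> sum \<mu> C" using \<mu>(2)[OF assoc_vertex_cover[OF C]] n by simp
    ultimately have "m C \<in> loc C (sumset_power U (Suc k))"
      using loc_mono[OF sumset_power_antimono[OF U_up]] by blast
    from up_closedD(1)[OF up_closed_loc[OF up_closed_sumset_power[OF U_up]] this, of "m (- C)"]
    show ?thesis unfolding m_def
      by (subst (asm) sum.union_disjoint[symmetric]) (auto simp: Compl_partition)
  qed
  then have "m UNIV \<in> (\<Inter>C\<in>assoc U. loc C (sumset_power U (Suc k)))" by (rule INT_I)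
  moreover have "1 \<le> Suc k" by simp
  ultimately have mem: "m UNIV \<in> sumset_power U (Suc k)" using symb by (simp only:)
  have card2: "2 \<le> card ({i, j} \<inter> UNIV)" if "(i, j) \<in> E" for i j
    using graphD(2)[OF that] by simp
  have "2 * Suc k \<le> (\<Sum>v\<in>UNIV. Poly_Mapping.lookup (m UNIV) v div w v)"
    by (rule sumset_power_div_sum[OF graphD(1) tail_weight[OF sinks] card2 mem])
  also have "\<dots> = sum \<mu> UNIV"
  proof (rule sum.cong)
    fix v
    have "Poly_Mapping.lookup (m UNIV) v = w v * \<mu> v"
      by (simp add: m_def lookup_sum lookup_single when_def)
    then show "Poly_Mapping.lookup (m UNIV) v div w v = \<mu> v" using graphD(1)[of v] by simp
  qed simp
  finally show False using \<mu>(1) n by simp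
qed

text \<open>A witness for an associated set \<open>C\<close> of the power, made large outside \<open>C\<close>, violates the condition
for a vertex cover \<open>D\<close>, which must then lie inside \<open>C\<close>. An associated set \<open>D'\<close> of the edge ideal inside
\<open>D\<close> contains \<open>C\<close>: a variable of \<open>C\<close> moves the witness into the power, but would not change the
capacity of \<open>D'\<close> if it were outside \<open>D'\<close>. So \<open>C\<close> is associated to the edge ideal. The converse
follows since associated sets of the edge ideal are minimal covers.\<close>

lemma assoc_power_eq:
  assumes sinks: "\<forall>v\<in>V_plus w. sink E v" and bip: "bipartite G" and n: "1 \<le> n"
  shows "assoc (sumset_power U n) = assoc U"
proof -
  let ?q = "\<lambda>a v. Poly_Mapping.lookup a v div w v"
  note w1 = tail_weight[OF sinks]
  obtain A where A: "\<forall>e\<in>G. \<exists>a\<in>A. \<exists>b\<in>- A. e = {a, b}" using bip by (auto simp: bipartite_def)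
  have parity: "(i \<in> A) \<noteq> (j \<in> A)" if "(i, j) \<in> E" for i j
    using A graphD(4)[of i j] that by (fastforce simp: doubleton_eq_iff)
  have mem: "a \<in> sumset_power U n \<longleftrightarrow> (\<forall>C. vertex_cover E C \<longrightarrow> n \<le> sum (?q a) C)" for a
  proof
    assume a: "a \<in> sumset_power U n"
    show "\<forall>C. vertex_cover E C \<longrightarrow> n \<le> sum (?q a) C"
    proof (intro allI impI)
      fix C assume C: "vertex_cover E C"
      have card1: "1 \<le> card ({i, j} \<inter> C)" if "(i, j) \<in> E" for i j
      proof -
        have "{i, j} \<inter> C \<noteq> {}" using C that by (auto simp: vertex_cover_def)
        then show ?thesis by (simp add: Suc_le_eq card_gt_0_iff)
      qed
      have "1 * n \<le> sum (?q a) C" by (rule sumset_power_div_sum[OF graphD(1) w1 card1 a])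
      then show "n \<le> sum (?q a) C" by simp
    qed
  qed (use sumset_power_if_covers[OF graphD(1) w1 parity] in blast)
  have sub: "assoc (sumset_power U n) \<subseteq> assoc U"
  proof
    fix C assume "C \<in> assoc (sumset_power U n)"
    then obtain a where a: "\<And>b. a + b \<in> sumset_power U n \<longleftrightarrow> b \<in> meets C" by (auto simp: assoc_def)
    \<comment> \<open>The exponent $n w_v$ gives capacity $n$ at every vertex outside \<open>C\<close>.\<close>
    define b where "b = (\<Sum>v\<in>- C. Poly_Mapping.single v (n * w v))"
    have b: "Poly_Mapping.lookup b v = (if v \<in> C then 0 else n * w v)" for v
      by (simp add: b_def lookup_sum lookup_single when_def)
    have "b \<notin> meets C" by (auto simp: meets_def in_keys_iff b)
    then have "a + b \<notin> sumset_power U n" by (simp add: a)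
    then obtain D where D: "vertex_cover E D" "sum (?q (a + b)) D < n" by (auto simp: mem not_le)
    have DC: "D \<subseteq> C"
    proof (rule subsetI, rule ccontr)
      fix v assume v: "v \<in> D" "v \<notin> C"
      have "n * w v div w v \<le> ?q (a + b) v" using v by (intro div_le_mono) (simp add: lookup_add b)
      moreover have "?q (a + b) v \<le> sum (?q (a + b)) D" using v by (intro member_le_sum) auto
      ultimately show False using D(2) graphD(1)[of v] by simp
    qed
    obtain D' where D': "D' \<in> assoc U" "D' \<subseteq> D" using assoc_subset_cover[OF D(1)] by blast
    have "C \<subseteq> D'"
    proof (rule subsetI, rule ccontr)
      fix v assume v: "v \<in> C" "v \<notin> D'"
      have "a + Poly_Mapping.single v 1 \<in> sumset_power U n" using v by (simp add: a)
      then have "n \<le> sum (?q (a + Poly_Mapping.single v 1)) D'"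
        using assoc_vertex_cover[OF D'(1)] mem by blast
      also have "\<dots> = sum (?q a) D'"
        using v(2) by (intro sum.cong) (auto simp: lookup_add lookup_single when_def)
      also have "\<dots> \<le> sum (?q a) D" using D'(2) by (intro sum_mono2) auto
      also have "\<dots> \<le> sum (?q (a + b)) D" by (intro sum_mono div_le_mono) (simp add: lookup_add)
      finally show False using D(2) by simp
    qed
    then have "C = D'" using D' DC by blast
    then show "C \<in> assoc U" using D' by simp
  qed
  moreover have "assoc U \<subseteq> assoc (sumset_power U n)"
  proof
    fix C assume C: "C \<in> assoc U"
    have "sumset_power U n \<subseteq> sumset_power U 1" by (rule sumset_power_antimono[OF U_up n])
    also have "\<dots> \<subseteq> meets C"
      using assoc_cover[OF C U_up] by (auto simp: sumset_def meets_add)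
    finally obtain D where D: "D \<in> assoc (sumset_power U n)" "D \<subseteq> C"
      using cover_contains_assoc[OF up_closed_sumset_power[OF U_up]] by blast
    then have "D = C" using sub unmixed[OF C, of D] by blast
    then show "C \<in> assoc (sumset_power U n)" using D by simp
  qed
  ultimately show ?thesis by blast
qed

end

theorem corollary3p4:
  fixes G :: "'v::{finite, linorder} set set"
    and E :: "('v \<times> 'v) set"
    and w :: "'v \<Rightarrow> nat"
    and S :: "('v, 'k::field) mpoly ring"
    and I :: "('v, 'k) mpoly set"
  assumes "weighted_oriented_graph G E w"
    and "\<forall>v. source E v \<longrightarrow> w v = 1"
    and "S = ring_of_type_algebra"
    and "I = edge_ideal E w"
    and "\<not> (\<exists>P. embedded_prime S I P)"
  shows "((\<forall>n\<ge>1. Ass S (ideal_power S I n) = Ass S I) \<longleftrightarrow>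
           (\<forall>n\<ge>1. ideal_power S I n = symbolic_power I n)) \<and>
         ((\<forall>n\<ge>1. ideal_power S I n = symbolic_power I n) \<longleftrightarrow>
           (\<forall>v\<in>V_plus w. sink E v) \<and> bipartite G)"
proof -
  let ?U = "edge_exponents E w"
  have up: "up_closed ?U" and upn: "up_closed (sumset_power ?U n)" for n
    by (intro up_closed_edge_exponents up_closed_sumset_power)+
  have I: "I = mono_ideal ?U" using assms(4) edge_ideal_eq by simp
  have no_embedded: "\<not> (\<exists>P. embedded_prime ring_of_type_algebra (mono_ideal ?U :: ('v, 'k) mpoly set) P)"
    using assms(3,5) I by simp
  interpret unmixed_graph G E w
    by unfold_locales (use assms(1) no_embedded embedded_prime_mono_ideal_iff[OF up, where 'k = 'k] in blast)+
  have Ass_iff: "Ass S (ideal_power S I n) = Ass S I \<longleftrightarrow> assoc (sumset_power ?U n) = assoc ?U" for n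
  proof -
    have "inj (var_prime :: 'v set \<Rightarrow> ('v, 'k) mpoly set)"
      by (rule injI) (simp add: var_prime_eq_iff)
    then show ?thesis
      unfolding assms(3) I ideal_power_mono_ideal[OF up] Ass_mono_ideal[OF upn] Ass_mono_ideal[OF up]
      by (simp add: inj_image_eq_iff)
  qed
  have symb_iff: "ideal_power S I n = symbolic_power I n \<longleftrightarrow>
    sumset_power ?U n = (\<Inter>C\<in>assoc ?U. loc C (sumset_power ?U n))" for n
    unfolding assms(3) I ideal_power_mono_ideal[OF up] symbolic_power_mono_ideal[OF up no_embedded]
    by (rule mono_ideal_eq_iff)
  have ab: "\<forall>n\<ge>1. ideal_power S I n = symbolic_power I n"
    if a: "\<forall>n\<ge>1. Ass S (ideal_power S I n) = Ass S I"
    unfolding symb_iff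
  proof (intro allI impI)
    fix n :: nat assume "1 \<le> n"
    then have "assoc (sumset_power ?U n) = assoc ?U" using a Ass_iff by blast
    then show "sumset_power ?U n = (\<Inter>C\<in>assoc ?U. loc C (sumset_power ?U n))"
      using Inter_loc_assoc[OF upn, of n] by simp
  qed
  have bc: "(\<forall>v\<in>V_plus w. sink E v) \<and> bipartite G"
    if b: "\<forall>n\<ge>1. ideal_power S I n = symbolic_power I n"
  proof -
    have b': "sumset_power ?U n = (\<Inter>C\<in>assoc ?U. loc C (sumset_power ?U n))" if "1 \<le> n" for n
      using b that symb_iff by blast
    have sinks: "\<forall>v\<in>V_plus w. sink E v"
      using heavy_vertex_is_sink[OF assms(2) b'] by simp
    then show ?thesis using underlying_graph_bipartite[OF sinks b'] by blast
  qed
  have ca: "\<forall>n\<ge>1. Ass S (ideal_power S I n) = Ass S I"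
    if "(\<forall>v\<in>V_plus w. sink E v) \<and> bipartite G"
    using that assoc_power_eq unfolding Ass_iff by blast
  show ?thesis using ab bc ca by blast
qed

end
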